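(* Let $M$ be an $n$-dimensional Frobenius manifold and let $p\in M\setminus\mathcal A_\Lambda$. Consider the linear system of differential equations in $z$ $$\frac{\partial}{\partial z}\xi=\Big(\mathcal U(p)^T-\frac1z\mu\Big)\xi$$ for the column vector $\xi=(\xi_1,\dots,\xi_n)^T$ of components of a covector with respect to $dt^1,\dots,dt^n$. The system can be reduced to a single scalar linear ordinary differential equation of order $n$ in the unknown function $\xi_1=\langle\xi,e\rangle$. This scalar differential equation admits at most $\binom{n-1}{2}$ apparent singularities.
   Context: A Frobenius manifold is a complex manifold $M$ of dimension $n$ with: a nondegenerate symmetric $\mathcal O(M)$-bilinear metric $\eta$ on $TM$ with flat Levi-Civita connection $\nabla$; a commutative associative product $\circ$ on $TM$, given by a $(1,2)$-tensor $c$, such that $c^\flat(X,Y,Z)=\eta(X,Y\circ Z)$ and $\nabla c^\flat$ are totally symmetric; a unit vector field $e$ with $\nabla e=0$; an Euler vector field $E$ with $\mathfrak L_Ec=c$ and $\mathfrak L_E\eta=(2-d)\eta$, where $d\in\mathbb C$ is the charge. Standing assumptions: the flat endomorphism $X\mapsto\nabla_XE$ is diagonalizable, flat coordinates $t^1,\dots,t^n$ are chosen with $\partial/\partial t^1=e$ (and so that $\nabla E$ is diagonal), and $M$ is generically semisimple (the set of points $p$ where $(T_pM,\circ_p)$ has no nilpotents is nonempty). Put $\boldsymbol\mu(Y)=\frac{2-d}{2}Y-\nabla_YE$ and $\boldsymbol{\mathcal U}(Y)=E\circ Y$; $\mu$ and $\mathcal U$ are their matrices with respect to $\partial/\partial t^\alpha$.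 Let $\widehat M=\mathbb C^*\times M$, $\pi:\widehat M\to M$ the projection. On $\pi^*TM$ let $\widehat\nabla_XY=\nabla_XY+zX\circ Y$, $\widehat\nabla_{\partial/\partial z}Y=\nabla_{\partial/\partial z}Y+\boldsymbol{\mathcal U}(Y)-\frac1z\boldsymbol\mu(Y)$, where $\nabla_{\partial/\partial z}Y=0$ for $Y$ pulled back from $M$. Put $e_k=\widehat\nabla^k_{\partial/\partial z}e$. The cyclic stratum $\widehat M^{\rm cyc}$ is the maximal open subset of $\widehat M$ on which $(e_0,\dots,e_{n-1})$ is a basis of each fiber of $\pi^*TM$. The $\mathcal A_\Lambda$-stratum is $\mathcal A_\Lambda=\{p\in M:\ \mathbb C^*\times\{p\}\subseteq\widehat M\setminus\widehat M^{\rm cyc}\}$. The system displayed in the claim is the equation $\widehat\nabla_{\partial/\partial z}\xi=0$ (dual connection on $\pi^*T^*M$) restricted to the point $p$. "Reduced" means: after a linear change of unknowns with coefficients rational in $z$ it becomes the companion system of a scalar linear equation in $\xi_1$, so that $\xi\mapsto\xi_1$ is a bijection between solutions of the system and solutions of the scalar equation. An apparent singularity is a singular point $z_0\in\mathbb C^*$ of the scalar equation at which all its solutions are holomorphic. *)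

theory Defs
  imports "HOL-Complex_Analysis.Complex_Analysis" "HOL-Library.FuncSet"
begin

section \<open>Complex manifolds\<close>

text \<open>
  A chart is a pair of a domain and a coordinate map.  The underlying set of a manifold is the
  union of the domains of its atlas; its topology is induced from the ambient type, whose
  sort supplies the Hausdorff property and second countability.
\<close>

type_synonym ('m, 'n) chart = "'m set \<times> ('m \<Rightarrow> complex ^ 'n)"

definition chart_inv :: "('m, 'n::finite) chart \<Rightarrow> complex ^ 'n \<Rightarrow> 'm" where
  "chart_inv c = inv_into (fst c) (snd c)"

definition holomorphic_vec_on :: "(complex ^ 'n \<Rightarrow> complex) \<Rightarrow> (complex ^ 'n::finite) set \<Rightarrow> bool" where
  "holomorphic_vec_on f S \<longleftrightarrow>
     (\<forall>x\<in>S. \<exists>f'. (f has_derivative f') (at x) \<and> (\<forall>a v. f' (a *s v) = a * f' v))"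

definition is_chart :: "('m::topological_space, 'n::finite) chart \<Rightarrow> bool" where
  "is_chart c \<longleftrightarrow> open (fst c) \<and> open (snd c ` fst c) \<and>
     homeomorphism (fst c) (snd c ` fst c) (snd c) (chart_inv c)"

definition holomorphic_transition :: "('m, 'n::finite) chart \<Rightarrow> ('m, 'n) chart \<Rightarrow> bool" where
  "holomorphic_transition c c' \<longleftrightarrow>
     (\<forall>i. holomorphic_vec_on (\<lambda>x. snd c' (chart_inv c x) $ i) (snd c ` (fst c \<inter> fst c')))"

definition carrier_of :: "('m, 'n::finite) chart set \<Rightarrow> 'm set" where
  "carrier_of \<A> = (\<Union>c\<in>\<A>. fst c)"

text \<open>A complex structure is given by its maximal holomorphic atlas.\<close>

definition complex_manifold :: "('m::{t2_space, second_countable_topology}, 'n::finite) chart set \<Rightarrow> bool" where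
  "complex_manifold \<A> \<longleftrightarrow>
     (\<forall>c\<in>\<A>. is_chart c) \<and>
     (\<forall>c\<in>\<A>. \<forall>c'\<in>\<A>. holomorphic_transition c c') \<and>
     (\<forall>c. is_chart c \<longrightarrow> fst c \<subseteq> carrier_of \<A> \<longrightarrow>
        (\<forall>c'\<in>\<A>. holomorphic_transition c c' \<and> holomorphic_transition c' c) \<longrightarrow> c \<in> \<A>)"

definition holomorphic_in_chart :: "('m, 'n::finite) chart \<Rightarrow> ('m \<Rightarrow> complex) \<Rightarrow> bool" where
  "holomorphic_in_chart c f \<longleftrightarrow> holomorphic_vec_on (\<lambda>x. f (chart_inv c x)) (snd c ` fst c)"

text \<open>The coordinate derivative \<open>\<partial>f/\<partial>x\<^sup>i\<close> at the point \<open>q\<close>, for the coordinates \<open>x = snd c\<close>.\<close>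

definition pd :: "('m, 'n::finite) chart \<Rightarrow> 'n \<Rightarrow> ('m \<Rightarrow> complex) \<Rightarrow> 'm \<Rightarrow> complex" where
  "pd c i f q = deriv (\<lambda>t. f (chart_inv c (snd c q + t *s axis i 1))) 0"

text \<open>\<open>jac c c' q a i = \<partial>x'\<^sup>a/\<partial>x\<^sup>i\<close>.\<close>

definition jac :: "('m, 'n::finite) chart \<Rightarrow> ('m, 'n) chart \<Rightarrow> 'm \<Rightarrow> 'n \<Rightarrow> 'n \<Rightarrow> complex" where
  "jac c c' q a i = pd c i (\<lambda>r. snd c' r $ a) q"


section \<open>Holomorphic tensor fields\<close>

text \<open>
  A tensor field is the family of its components in all charts of the atlas, subject to the
  tensorial transformation law on overlaps.
\<close>

type_synonym ('m, 'n) vfield = "('m, 'n) chart \<Rightarrow> 'm \<Rightarrow> complex ^ 'n"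
type_synonym ('m, 'n) tensor02 = "('m, 'n) chart \<Rightarrow> 'm \<Rightarrow> complex ^ 'n ^ 'n"
type_synonym ('m, 'n) tensor12 = "('m, 'n) chart \<Rightarrow> 'm \<Rightarrow> 'n \<Rightarrow> 'n \<Rightarrow> 'n \<Rightarrow> complex"

definition vector_field :: "('m, 'n::finite) chart set \<Rightarrow> ('m, 'n::finite) vfield \<Rightarrow> bool" where
  "vector_field \<A> X \<longleftrightarrow>
     (\<forall>c\<in>\<A>. \<forall>i. holomorphic_in_chart c (\<lambda>q. X c q $ i)) \<and>
     (\<forall>c\<in>\<A>. \<forall>c'\<in>\<A>. \<forall>q\<in>fst c \<inter> fst c'. \<forall>a.
        X c' q $ a = (\<Sum>i\<in>UNIV. jac c c' q a i * X c q $ i))"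

definition tensor_field02 :: "('m, 'n::finite) chart set \<Rightarrow> ('m, 'n::finite) tensor02 \<Rightarrow> bool" where
  "tensor_field02 \<A> g \<longleftrightarrow>
     (\<forall>c\<in>\<A>. \<forall>i j. holomorphic_in_chart c (\<lambda>q. g c q $ i $ j)) \<and>
     (\<forall>c\<in>\<A>. \<forall>c'\<in>\<A>. \<forall>q\<in>fst c \<inter> fst c'. \<forall>i j.
        g c q $ i $ j =
          (\<Sum>a\<in>UNIV. \<Sum>b\<in>UNIV. jac c c' q a i * jac c c' q b j * g c' q $ a $ b))"

text \<open>\<open>T c q k i j\<close> is the component \<open>T\<^sup>k\<^sub>i\<^sub>j\<close>.\<close>

definition tensor_field12 :: "('m, 'n::finite) chart set \<Rightarrow> ('m, 'n::finite) tensor12 \<Rightarrow> bool" where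
  "tensor_field12 \<A> T \<longleftrightarrow>
     (\<forall>c\<in>\<A>. \<forall>k i j. holomorphic_in_chart c (\<lambda>q. T c q k i j)) \<and>
     (\<forall>c\<in>\<A>. \<forall>c'\<in>\<A>. \<forall>q\<in>fst c \<inter> fst c'. \<forall>a i j.
        (\<Sum>k\<in>UNIV. jac c c' q a k * T c q k i j) =
          (\<Sum>b\<in>UNIV. \<Sum>l\<in>UNIV. jac c c' q b i * jac c c' q l j * T c' q a b l))"

text \<open>Christoffel symbols \<open>\<Gamma>\<^sup>k\<^sub>i\<^sub>j\<close> of the Levi-Civita connection of \<open>g\<close>.\<close>

definition christoffel :: "('m, 'n::finite) tensor02 \<Rightarrow> ('m, 'n::finite) tensor12" where
  "christoffel g c q k i j =
     (\<Sum>l\<in>UNIV. matrix_inv (g c q) $ k $ l *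
        (pd c i (\<lambda>r. g c r $ l $ j) q + pd c j (\<lambda>r. g c r $ l $ i) q
          - pd c l (\<lambda>r. g c r $ i $ j) q)) / 2"

text \<open>\<open>riemann g c q l k i j\<close> is the \<open>\<partial>\<^sub>l\<close>-component of \<open>R(\<partial>\<^sub>i, \<partial>\<^sub>j) \<partial>\<^sub>k\<close>.\<close>

definition riemann :: "('m, 'n::finite) tensor02 \<Rightarrow> ('m, 'n::finite) chart \<Rightarrow> 'm \<Rightarrow> 'n \<Rightarrow> 'n \<Rightarrow> 'n \<Rightarrow> 'n \<Rightarrow> complex" where
  "riemann g c q l k i j =
     pd c i (\<lambda>r. christoffel g c r l j k) q - pd c j (\<lambda>r. christoffel g c r l i k) q
     + (\<Sum>m\<in>UNIV. christoffel g c q l i m * christoffel g c q m j k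
                 - christoffel g c q l j m * christoffel g c q m i k)"

text \<open>\<open>cov_vec g X c q $ i $ j = (\<nabla>\<^sub>j X)\<^sup>i\<close>, the matrix of the endomorphism \<open>Y \<mapsto> \<nabla>\<^sub>Y X\<close>.\<close>

definition cov_vec :: "('m, 'n::finite) tensor02 \<Rightarrow> ('m, 'n::finite) vfield \<Rightarrow> ('m, 'n) chart \<Rightarrow> 'm \<Rightarrow> complex ^ 'n ^ 'n" where
  "cov_vec g X c q = (\<chi> i j. pd c j (\<lambda>r. X c r $ i) q
                              + (\<Sum>m\<in>UNIV. christoffel g c q i j m * X c q $ m))"

text \<open>\<open>flat_prod g T\<close> has the components of \<open>c\<^sup>\<flat>(X, Y, Z) = \<eta>(X, Y \<circ> Z)\<close>, and
  \<open>cov_flat_prod g T c q l i j k = (\<nabla>\<^sub>l c\<^sup>\<flat>)\<^sub>i\<^sub>j\<^sub>k\<close>.\<close>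

definition flat_prod :: "('m, 'n::finite) tensor02 \<Rightarrow> ('m, 'n::finite) tensor12 \<Rightarrow>
    ('m, 'n) chart \<Rightarrow> 'm \<Rightarrow> 'n \<Rightarrow> 'n \<Rightarrow> 'n \<Rightarrow> complex" where
  "flat_prod g T c q i j k = (\<Sum>m\<in>UNIV. g c q $ i $ m * T c q m j k)"

definition cov_flat_prod :: "('m, 'n::finite) tensor02 \<Rightarrow> ('m, 'n::finite) tensor12 \<Rightarrow>
    ('m, 'n) chart \<Rightarrow> 'm \<Rightarrow> 'n \<Rightarrow> 'n \<Rightarrow> 'n \<Rightarrow> 'n \<Rightarrow> complex" where
  "cov_flat_prod g T c q l i j k =
     pd c l (\<lambda>r. flat_prod g T c r i j k) q
     - (\<Sum>m\<in>UNIV. christoffel g c q m l i * flat_prod g T c q m j k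
                 + christoffel g c q m l j * flat_prod g T c q i m k
                 + christoffel g c q m l k * flat_prod g T c q i j m)"

definition lie02 :: "('m, 'n::finite) vfield \<Rightarrow> ('m, 'n::finite) tensor02 \<Rightarrow>
    ('m, 'n) chart \<Rightarrow> 'm \<Rightarrow> 'n \<Rightarrow> 'n \<Rightarrow> complex" where
  "lie02 X g c q i j =
     (\<Sum>m\<in>UNIV. X c q $ m * pd c m (\<lambda>r. g c r $ i $ j) q
               + g c q $ m $ j * pd c i (\<lambda>r. X c r $ m) q
               + g c q $ i $ m * pd c j (\<lambda>r. X c r $ m) q)"

definition lie12 :: "('m, 'n::finite) vfield \<Rightarrow> ('m, 'n::finite) tensor12 \<Rightarrow> ('m, 'n) tensor12" where
  "lie12 X T c q k i j =
     (\<Sum>m\<in>UNIV. X c q $ m * pd c m (\<lambda>r. T c r k i j) q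
               - T c q m i j * pd c m (\<lambda>r. X c r $ k) q
               + T c q k m j * pd c i (\<lambda>r. X c r $ m) q
               + T c q k i m * pd c j (\<lambda>r. X c r $ m) q)"


section \<open>Frobenius manifolds\<close>

record ('m, 'n::finite) frobenius =
  atlas :: "('m, 'n) chart set"
  metric :: "('m, 'n) tensor02"
  mult :: "('m, 'n) tensor12"
  unit_field :: "('m, 'n) vfield"
  euler_field :: "('m, 'n) vfield"
  charge :: complex

abbreviation points :: "('m, 'n::finite) frobenius \<Rightarrow> 'm set" where
  "points F \<equiv> carrier_of (atlas F)"

definition frobenius_manifold :: "('m::{t2_space, second_countable_topology}, 'n::finite) frobenius \<Rightarrow> bool" where
  "frobenius_manifold F \<longleftrightarrow>
     complex_manifold (atlas F) \<and>
     tensor_field02 (atlas F) (metric F) \<and>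
     tensor_field12 (atlas F) (mult F) \<and>
     vector_field (atlas F) (unit_field F) \<and>
     vector_field (atlas F) (euler_field F) \<and>
     (\<forall>c\<in>atlas F. \<forall>q\<in>fst c.
        \<comment> \<open>nondegenerate symmetric flat metric\<close>
        (\<forall>i j. metric F c q $ i $ j = metric F c q $ j $ i) \<and>
        invertible (metric F c q) \<and>
        (\<forall>l k i j. riemann (metric F) c q l k i j = 0) \<and>
        \<comment> \<open>commutative associative product with unit\<close>
        (\<forall>k i j. mult F c q k i j = mult F c q k j i) \<and>
        (\<forall>l i j k. (\<Sum>m\<in>UNIV. mult F c q m i j * mult F c q l m k) =
                   (\<Sum>m\<in>UNIV. mult F c q l i m * mult F c q m j k)) \<and>
        (\<forall>k j. (\<Sum>i\<in>UNIV. unit_field F c q $ i * mult F c q k i j) = (if k = j then 1 else 0)) \<and>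
        \<comment> \<open>total symmetry of \<open>c\<^sup>\<flat>\<close> and \<open>\<nabla>c\<^sup>\<flat>\<close>\<close>
        (\<forall>i j k. flat_prod (metric F) (mult F) c q i j k = flat_prod (metric F) (mult F) c q j i k \<and>
                 flat_prod (metric F) (mult F) c q i j k = flat_prod (metric F) (mult F) c q i k j) \<and>
        (\<forall>l i j k.
           cov_flat_prod (metric F) (mult F) c q l i j k = cov_flat_prod (metric F) (mult F) c q i l j k \<and>
           cov_flat_prod (metric F) (mult F) c q l i j k = cov_flat_prod (metric F) (mult F) c q l j i k \<and>
           cov_flat_prod (metric F) (mult F) c q l i j k = cov_flat_prod (metric F) (mult F) c q l i k j) \<and>
        \<comment> \<open>flat unit, Euler field\<close>
        cov_vec (metric F) (unit_field F) c q = 0 \<and>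
        (\<forall>k i j. lie12 (euler_field F) (mult F) c q k i j = mult F c q k i j) \<and>
        (\<forall>i j. lie02 (euler_field F) (metric F) c q i j = (2 - charge F) * metric F c q $ i $ j))"

definition diagonalizable :: "complex ^ 'n::finite ^ 'n \<Rightarrow> bool" where
  "diagonalizable A \<longleftrightarrow>
     (\<exists>P D :: complex ^ 'n ^ 'n. invertible P \<and> (\<forall>i j. i \<noteq> j \<longrightarrow> D $ i $ j = 0) \<and> A ** P = P ** D)"

definition euler_diagonalizable :: "('m, 'n::finite) frobenius \<Rightarrow> bool" where
  "euler_diagonalizable F \<longleftrightarrow>
     (\<forall>c\<in>atlas F. \<forall>q\<in>fst c. diagonalizable (cov_vec (metric F) (euler_field F) c q))"

definition tangent_mult :: "('m, 'n::finite) frobenius \<Rightarrow> ('m, 'n::finite) chart \<Rightarrow> 'm \<Rightarrow>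
    complex ^ 'n \<Rightarrow> complex ^ 'n \<Rightarrow> complex ^ 'n" where
  "tangent_mult F c q v w =
     (\<chi> k. \<Sum>i\<in>UNIV. \<Sum>j\<in>UNIV. mult F c q k i j * v $ i * w $ j)"

definition semisimple_at :: "('m, 'n::finite) frobenius \<Rightarrow> 'm \<Rightarrow> bool" where
  "semisimple_at F q \<longleftrightarrow>
     (\<forall>c\<in>atlas F. q \<in> fst c \<longrightarrow>
        (\<forall>v m. (tangent_mult F c q v ^^ m) v = 0 \<longrightarrow> v = 0))"

definition generically_semisimple :: "('m, 'n::finite) frobenius \<Rightarrow> bool" where
  "generically_semisimple F \<longleftrightarrow> {q \<in> points F. semisimple_at F q} \<noteq> {}"

text \<open>Matrices, in the coordinate frame of \<open>c\<close>, of \<open>\<mu> = (2 - d)/2 - \<nabla>E\<close> and of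
  \<open>\<U> = E \<circ>\<close>.\<close>

definition mu_matrix :: "('m, 'n::finite) frobenius \<Rightarrow> ('m, 'n::finite) chart \<Rightarrow> 'm \<Rightarrow> complex ^ 'n ^ 'n" where
  "mu_matrix F c q = mat ((2 - charge F) / 2) - cov_vec (metric F) (euler_field F) c q"

definition U_matrix :: "('m, 'n::finite) frobenius \<Rightarrow> ('m, 'n::finite) chart \<Rightarrow> 'm \<Rightarrow> complex ^ 'n ^ 'n" where
  "U_matrix F c q = matrix (tangent_mult F c q (euler_field F c q))"

text \<open>
  Flat coordinates \<open>t\<^sup>1, \<dots>, t\<^sup>n\<close> with \<open>\<partial>/\<partial>t\<^sup>1 = e\<close> in which \<open>\<nabla>E\<close> is diagonal.  The index type
  \<open>'n\<close> carries no order, so the index playing the role of \<open>1\<close> is the argument \<open>u\<close>.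
\<close>

definition adapted_flat_chart :: "('m, 'n::finite) frobenius \<Rightarrow> 'n \<Rightarrow> ('m, 'n::finite) chart \<Rightarrow> bool" where
  "adapted_flat_chart F u c \<longleftrightarrow> c \<in> atlas F \<and>
     (\<forall>q\<in>fst c.
        (\<forall>k i j. christoffel (metric F) c q k i j = 0) \<and>
        unit_field F c q = axis u 1 \<and>
        (\<forall>i j. i \<noteq> j \<longrightarrow> cov_vec (metric F) (euler_field F) c q $ i $ j = 0))"


section \<open>The extended connection and the cyclic stratum\<close>

text \<open>
  Sections of \<open>\<pi>\<^sup>*TM\<close> over \<open>\<complex>\<^sup>* \<times> M\<close>, by components in the frames pulled back from the charts
  of \<open>M\<close>.  As transition functions do not involve \<open>z\<close>, \<open>\<nabla>\<^bsub>\<partial>/\<partial>z\<^esub>\<close> differentiates components.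
\<close>

type_synonym ('m, 'n) pb_section = "('m, 'n) chart \<Rightarrow> complex \<times> 'm \<Rightarrow> complex ^ 'n"

definition hat_nabla_z :: "('m, 'n::finite) frobenius \<Rightarrow> ('m, 'n::finite) pb_section \<Rightarrow> ('m, 'n) pb_section" where
  "hat_nabla_z F Y c = (\<lambda>(z, q).
     (\<chi> i. deriv (\<lambda>w. Y c (w, q) $ i) z)
     + U_matrix F c q *v Y c (z, q) - (1 / z) *s (mu_matrix F c q *v Y c (z, q)))"

definition cyclic_vec :: "('m, 'n::finite) frobenius \<Rightarrow> nat \<Rightarrow> ('m, 'n::finite) pb_section" where
  "cyclic_vec F k = (hat_nabla_z F ^^ k) (\<lambda>c (z, q). unit_field F c q)"

definition cyclic_frame_at :: "('m, 'n::finite) frobenius \<Rightarrow> complex \<times> 'm \<Rightarrow> bool" where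
  "cyclic_frame_at F x \<longleftrightarrow>
     (\<forall>c\<in>atlas F. snd x \<in> fst c \<longrightarrow>
        inj_on (\<lambda>k. cyclic_vec F k c x) {..<CARD('n)} \<and>
        vec.independent ((\<lambda>k. cyclic_vec F k c x) ` {..<CARD('n)}) \<and>
        vec.span ((\<lambda>k. cyclic_vec F k c x) ` {..<CARD('n)}) = UNIV)"

definition hat_M :: "('m, 'n::finite) frobenius \<Rightarrow> (complex \<times> 'm) set" where
  "hat_M F = (UNIV - {0}) \<times> points F"

definition cyclic_stratum :: "('m::topological_space, 'n::finite) frobenius \<Rightarrow> (complex \<times> 'm) set" where
  "cyclic_stratum F = \<Union>{W. open W \<and> W \<subseteq> hat_M F \<and> (\<forall>x\<in>W. cyclic_frame_at F x)}"

definition A_Lambda :: "('m::topological_space, 'n::finite) frobenius \<Rightarrow> 'm set" where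
  "A_Lambda F = {q \<in> points F. (UNIV - {0}) \<times> {q} \<subseteq> hat_M F - cyclic_stratum F}"

definition deformed_matrix :: "('m, 'n::finite) frobenius \<Rightarrow> ('m, 'n::finite) chart \<Rightarrow> 'm \<Rightarrow> complex \<Rightarrow> complex ^ 'n ^ 'n" where
  "deformed_matrix F c q z =
     (\<chi> i j. transpose (U_matrix F c q) $ i $ j - (1 / z) * mu_matrix F c q $ i $ j)"


section \<open>Reduction of a linear system to a scalar equation\<close>

text \<open>
  Rational functions in lowest terms: with \<open>x / 0 = 0\<close>, the value at a point that is not a pole
  is then the correct one, and the poles are exactly the zeros of the denominator.
\<close>

definition rational_fun :: "(complex \<Rightarrow> complex) \<Rightarrow> bool" where
  "rational_fun f \<longleftrightarrow> (\<exists>r s. s \<noteq> 0 \<and> coprime r s \<and> f = (\<lambda>z. poly r z / poly s z))"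

text \<open>
  A scalar equation \<open>y\<^bsup>(n)\<^esup> + a\<^bsub>n-1\<^esub> y\<^bsup>(n-1)\<^esup> + \<dots> + a\<^sub>0 y = 0\<close> is given by its coefficients
  \<open>a\<^sub>j\<close>, \<open>j < n\<close>.
\<close>

definition singular_points :: "nat \<Rightarrow> (nat \<Rightarrow> complex \<Rightarrow> complex) \<Rightarrow> complex set" where
  "singular_points n a = {z0. z0 \<noteq> 0 \<and> (\<exists>j<n. is_pole (a j) z0)}"

text \<open>Solutions on an open set \<open>D\<close>, as functions that are \<open>undefined\<close> off \<open>D\<close>.\<close>

definition scalar_solutions :: "nat \<Rightarrow> (nat \<Rightarrow> complex \<Rightarrow> complex) \<Rightarrow> complex set \<Rightarrow> (complex \<Rightarrow> complex) set" where
  "scalar_solutions n a D =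
     {y \<in> extensional D. y holomorphic_on D \<and>
        (\<forall>z\<in>D. (deriv ^^ n) y z + (\<Sum>j<n. a j z * (deriv ^^ j) y z) = 0)}"

definition system_solutions :: "(complex \<Rightarrow> complex ^ 'n ^ 'n::finite) \<Rightarrow> complex set \<Rightarrow> (complex \<Rightarrow> complex ^ 'n) set" where
  "system_solutions A D =
     {\<xi> \<in> extensional D. \<forall>z\<in>D. \<forall>i.
        ((\<lambda>w. \<xi> w $ i) has_field_derivative (A z *v \<xi> z) $ i) (at z)}"

text \<open>
  All local solutions near \<open>z\<^sub>0\<close>, which a priori may be multivalued on a punctured
  neighbourhood, extend holomorphically to \<open>z\<^sub>0\<close>.
\<close>

definition apparent_singularities :: "nat \<Rightarrow> (nat \<Rightarrow> complex \<Rightarrow> complex) \<Rightarrow> complex set" where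
  "apparent_singularities n a =
     {z0 \<in> singular_points n a.
        \<exists>r>0. (ball z0 r - {z0}) \<inter> insert 0 (singular_points n a) = {} \<and>
          (\<forall>D. open D \<and> connected D \<and> D \<noteq> {} \<and> D \<subseteq> ball z0 r - {z0} \<longrightarrow>
             (\<forall>y\<in>scalar_solutions n a D.
                \<exists>h. h holomorphic_on ball z0 r \<and> (\<forall>z\<in>D. h z = y z)))}"

text \<open>
  The change of unknowns \<open>y\<^sub>k = \<Sum>\<^sub>i G\<^sub>k\<^sub>i \<xi>\<^sub>i\<close> (\<open>k < n\<close>), invertible over the field of rational
  functions with inverse \<open>H\<close> and with \<open>y\<^sub>0 = \<xi>\<^sub>u\<close>, turns \<open>\<xi>' = A \<xi>\<close> into the companion system
  of the equation with coefficients \<open>a\<close>: if \<open>C\<close> is the companion matrix, then \<open>G' + G A = C G\<close>.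
\<close>

definition gauge_to_companion :: "(complex \<Rightarrow> complex ^ 'n ^ 'n::finite) \<Rightarrow> 'n::finite \<Rightarrow> (nat \<Rightarrow> complex \<Rightarrow> complex) \<Rightarrow>
    (nat \<Rightarrow> 'n \<Rightarrow> complex \<Rightarrow> complex) \<Rightarrow> ('n \<Rightarrow> nat \<Rightarrow> complex \<Rightarrow> complex) \<Rightarrow> bool" where
  "gauge_to_companion A u a G H \<longleftrightarrow>
     (\<forall>k<CARD('n). \<forall>i. rational_fun (G k i) \<and> rational_fun (H i k)) \<and>
     (\<forall>i. G 0 i = (\<lambda>z. if i = u then 1 else 0)) \<and>
     (\<forall>\<^sub>\<infinity>z. \<forall>i j. (\<Sum>k<CARD('n). H i k z * G k j z) = (if i = j then 1 else 0)) \<and>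
     (\<forall>\<^sub>\<infinity>z. \<forall>k<CARD('n). \<forall>i.
        deriv (G k i) z + (\<Sum>j\<in>UNIV. G k j z * A z $ j $ i) =
          (if Suc k < CARD('n) then G (Suc k) i z else - (\<Sum>j<CARD('n). a j z * G j i z)))"

definition reduces_to_scalar :: "(complex \<Rightarrow> complex ^ 'n ^ 'n::finite) \<Rightarrow> 'n::finite \<Rightarrow> (nat \<Rightarrow> complex \<Rightarrow> complex) \<Rightarrow> bool" where
  "reduces_to_scalar A u a \<longleftrightarrow>
     (\<forall>j<CARD('n). rational_fun (a j)) \<and>
     (\<exists>G H. gauge_to_companion A u a G H) \<and>
     (\<forall>D. open D \<and> D \<inter> insert 0 (singular_points CARD('n) a) = {} \<longrightarrow>
        bij_betw (\<lambda>\<xi>. \<lambda>z\<in>D. \<xi> z $ u) (system_solutions A D) (scalar_solutions CARD('n) a D))"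

end

theory Submission
  imports Defs "HOL-Computational_Algebra.Polynomial_Factorial"
    "HOL-Computational_Algebra.Field_as_Ring"
begin

text \<open>
  Fix the point \<open>p\<close>.  If \<open>\<xi>\<close> solves the system, then the \<open>k\<close>-th derivative of \<open>y = \<langle>\<xi>, e\<rangle>\<close> is
  \<open>\<langle>\<xi>, e\<^sub>k\<rangle>\<close>, because the connections on vectors and covectors are dual.  So the matrix \<open>W\<close> with the
  rows \<open>e\<^sub>0, \<dots>, e\<^sub>n\<^sub>-\<^sub>1\<close> transforms the system into a companion system, and the coefficients of the
  scalar equation are those of the expansion of \<open>- e\<^sub>n\<close> in this frame.  By Cramer's rule their
  only possible poles in \<open>\<complex>\<^sup>*\<close> are the zeros of \<open>det W\<close>.  Moreover every reduction has these
  coefficients off a finite set, since the gauge is determined recursively by its first row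
  (\<open>reduction_coefficients\<close>).  It remains to count the zeros of \<open>det W\<close>, among which all singular
  points, apparent or not, are to be found (\<open>singular_points_degenerate\<close>).

  The vector \<open>e\<^sub>k\<close> is a polynomial of degree at most \<open>k\<close> in \<open>1/z\<close>, which bounds the degree of
  \<open>det W\<close> by \<open>n choose 2\<close> only.  But \<open>e\<close> is an eigenvector of \<open>\<mu>\<close>, and therefore the coefficient of degree
  \<open>k\<close> in \<open>e\<^sub>k\<close> is a multiple of \<open>e = e\<^sub>0\<close>.  Modulo the row \<open>e\<^sub>0\<close> the degree of every row \<open>e\<^sub>k\<close> with
  \<open>k > 0\<close> drops to \<open>k - 1\<close>, and the bound becomes \<open>(n - 1) choose 2\<close>
  (\<open>degree_frame_det_poly\<close>).  The determinant is not identically zero since \<open>p\<close> lies outside the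
  \<open>\<A>\<^sub>\<Lambda>\<close>-stratum.

  For the existence of a reduction, \<open>\<xi> \<mapsto> y\<close> must be bijective over every region in which the scalar
  equation is regular, whereas \<open>y \<mapsto> W\<^sup>-\<^sup>1 (y, y', \<dots>)\<close> is an inverse only where \<open>det W\<close> does not
  vanish.  Liouville's formula for the gauge transformation shows that \<open>det W\<close> cannot vanish where
  the coefficients are regular (\<open>nondegenerate_if_regular\<close>).
\<close>

no_notation fps_nth (infixl "$" 75)

section \<open>Determinants and inverses of matrix functions\<close>

lemma matrix_inv_mult:
  fixes A :: "complex ^ 'n::finite ^ 'n"
  assumes "det A \<noteq> 0"
  shows "A ** matrix_inv A = mat 1" and "matrix_inv A ** A = mat 1"
proof -
  have "\<exists>B. A ** B = mat 1 \<and> B ** A = mat 1"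
    using assms invertible_det_nz[of A] by (simp add: invertible_def)
  then have "A ** matrix_inv A = mat 1 \<and> matrix_inv A ** A = mat 1"
    unfolding matrix_inv_def by (rule someI_ex)
  then show "A ** matrix_inv A = mat 1" "matrix_inv A ** A = mat 1" by auto
qed

text \<open>
  By Cramer's rule the inverse is built from determinants by one division; holomorphy and
  rationality therefore pass from the entries of a matrix to those of its inverse.
\<close>

lemma matrix_inv_entry:
  fixes A :: "complex ^ 'n::finite ^ 'n"
  assumes "det A \<noteq> 0"
  shows "matrix_inv A $ i $ j = det (\<chi> k l. if l = i then (axis j 1 :: complex ^ 'n) $ k else A $ k $ l) / det A"
proof -
  have "A *v (matrix_inv A *v axis j 1) = axis j 1"
    by (simp add: matrix_vector_mul_assoc matrix_inv_mult[OF assms])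
  then have "matrix_inv A *v axis j 1 =
      (\<chi> i. det (\<chi> k l. if l = i then (axis j 1 :: complex ^ 'n) $ k else A $ k $ l) / det A)"
    using cramer[OF assms] by blast
  moreover have "(matrix_inv A *v axis j 1) $ i = matrix_inv A $ i $ j"
    by (simp add: matrix_vector_mult_def axis_def if_distrib cong: if_cong)
  ultimately show ?thesis by simp
qed

lemma holomorphic_on_det:
  fixes A :: "complex \<Rightarrow> complex ^ 'n::finite ^ 'n"
  assumes "\<And>i j. (\<lambda>z. A z $ i $ j) holomorphic_on S"
  shows "(\<lambda>z. det (A z)) holomorphic_on S"
  unfolding det_def by (intro holomorphic_intros assms)

lemma holomorphic_on_matrix_inv:
  fixes A :: "complex \<Rightarrow> complex ^ 'n::finite ^ 'n"
  assumes "\<And>i j. (\<lambda>z. A z $ i $ j) holomorphic_on S"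
    and "\<And>z. z \<in> S \<Longrightarrow> det (A z) \<noteq> 0"
  shows "(\<lambda>z. matrix_inv (A z) $ i $ j) holomorphic_on S"
proof -
  have "(\<lambda>z. (\<chi> k l. if l = i then (axis j 1 :: complex ^ 'n) $ k else A z $ k $ l) $ k $ l) holomorphic_on S" for k l
    using assms(1)[of k l] by (cases "l = i") auto
  then have "(\<lambda>z. det (\<chi> k l. if l = i then (axis j 1 :: complex ^ 'n) $ k else A z $ k $ l) / det (A z)) holomorphic_on S"
    by (intro holomorphic_on_divide holomorphic_on_det assms)
  then show ?thesis
    by (rule holomorphic_transform) (simp add: matrix_inv_entry assms(2))
qed

lemma det_has_field_derivative:
  fixes W :: "complex \<Rightarrow> complex ^ 'n::finite ^ 'n"
  assumes "\<And>i j. ((\<lambda>w. W w $ i $ j) has_field_derivative V $ i $ j) (at z)"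
  shows "((\<lambda>w. det (W w)) has_field_derivative
            (\<Sum>i\<in>UNIV. det (\<chi> k. if k = i then V $ i else W z $ k))) (at z)"
proof -
  have split: "(\<Prod>k\<in>UNIV. (\<chi> k. if k = i then V $ i else W z $ k) $ k $ p k)
      = V $ i $ p i * (\<Prod>k\<in>UNIV - {i}. W z $ k $ p k)" for i and p :: "'n \<Rightarrow> 'n"
    by (subst prod.remove[of _ i]) (auto intro!: prod.cong)
  have "((\<lambda>w. det (W w)) has_field_derivative
      (\<Sum>p | p permutes (UNIV :: 'n set). of_int (sign p) *
        (\<Sum>i\<in>UNIV. V $ i $ p i * (\<Prod>k\<in>UNIV - {i}. W z $ k $ p k)))) (at z)"
    unfolding det_def by (intro DERIV_sum DERIV_cmult has_field_derivative_prod assms)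
  also have "(\<Sum>p | p permutes (UNIV :: 'n set). of_int (sign p) *
        (\<Sum>i\<in>UNIV. V $ i $ p i * (\<Prod>k\<in>UNIV - {i}. W z $ k $ p k)))
      = (\<Sum>i\<in>UNIV. det (\<chi> k. if k = i then V $ i else W z $ k))"
    unfolding det_def split sum_distrib_left by (rule sum.swap)
  finally show ?thesis .
qed

text \<open>
  Row \<open>i\<close> of \<open>K W\<close> is a combination of the rows of \<open>W\<close>, and only the multiple \<open>K\<^sub>i\<^sub>i\<close> of row \<open>i\<close>
  itself survives in a determinant that still contains the other rows.
\<close>

lemma det_has_field_derivative_trace:
  fixes W :: "complex \<Rightarrow> complex ^ 'n::finite ^ 'n"
  assumes "\<And>i j. ((\<lambda>w. W w $ i $ j) has_field_derivative (K ** W z) $ i $ j) (at z)"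
  shows "((\<lambda>w. det (W w)) has_field_derivative trace K * det (W z)) (at z)"
proof -
  have "(\<Sum>i\<in>UNIV. det (\<chi> k. if k = i then (K ** W z) $ i else W z $ k)) = trace K * det (W z)"
    unfolding trace_def sum_distrib_right
  proof (rule sum.cong[OF refl])
    fix i
    have "(\<chi> k. if k = i then (K ** W z) $ i else W z $ k)
        = (\<chi> k. if k = i then sum (\<lambda>l. (K $ i) $ l *s row l (W z)) UNIV else row k (W z))"
      by (simp add: vec_eq_iff matrix_matrix_mult_def row_def)
    then show "det (\<chi> k. if k = i then (K ** W z) $ i else W z $ k) = K $ i $ i * det (W z)"
      by (simp only: cramer_lemma_transpose)
  qed
  with det_has_field_derivative[of W "K ** W z" z] assms show ?thesis by simp
qed

text \<open>
  Liouville's formula for a matrix that is multiplied by connection matrices on both sides, as a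
  gauge transformation is: \<open>W' = (C - W A W\<^sup>-\<^sup>1) W\<close>, and \<open>W A W\<^sup>-\<^sup>1\<close> has the trace of \<open>A\<close>.
\<close>

lemma liouville:
  fixes W :: "complex \<Rightarrow> complex ^ 'n::finite ^ 'n"
  assumes "\<And>i j. ((\<lambda>w. W w $ i $ j) has_field_derivative (C ** W z - W z ** A) $ i $ j) (at z)"
    and "det (W z) \<noteq> 0"
  shows "((\<lambda>w. det (W w)) has_field_derivative (trace C - trace A) * det (W z)) (at z)"
proof -
  define K where "K = C - W z ** A ** matrix_inv (W z)"
  note inv = matrix_inv_mult[OF assms(2)]
  have "K ** W z = C ** W z - (W z ** A ** matrix_inv (W z)) ** W z"
    by (simp add: K_def matrix_matrix_mult_def vec_eq_iff left_diff_distrib sum_subtractf)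
  also have "(W z ** A ** matrix_inv (W z)) ** W z = W z ** A"
    by (simp add: matrix_mul_assoc[symmetric] inv)
  finally have K: "K ** W z = C ** W z - W z ** A" .
  have "trace (W z ** A ** matrix_inv (W z)) = trace (matrix_inv (W z) ** (W z ** A))"
    by (rule trace_mul_sym)
  also have "\<dots> = trace A"
    by (simp add: matrix_mul_assoc inv)
  finally have "trace K = trace C - trace A"
    by (simp add: K_def trace_sub)
  then show ?thesis
    using det_has_field_derivative_trace[of W K z] assms(1) K by simp
qed

lemma isCont_eqI:
  fixes f g :: "complex \<Rightarrow> complex"
  assumes "isCont f z" "isCont g z" "\<forall>\<^sub>F w in at z. f w = g w"
  shows "f z = g z"
proof -
  have "(f \<longlongrightarrow> g z) (at z)"
    using assms(2,3) by (simp add: isCont_def tendsto_cong)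
  then show ?thesis
    using assms(1) by (metis LIM_unique isCont_def)
qed

text \<open>
  Uniqueness for \<open>d' = g d\<close>: if \<open>G\<close> is a primitive of \<open>g\<close>, then \<open>d exp (-G)\<close> is constant.  The
  equation is demanded only off the centre \<open>z\<close>, because Liouville's formula will supply it only
  where \<open>d = det W\<close> does not vanish.
\<close>

lemma linear_ode_zero:
  fixes d g :: "complex \<Rightarrow> complex"
  assumes d: "d holomorphic_on ball z r" and g: "g holomorphic_on ball z r"
    and ode: "\<And>w. w \<in> ball z r \<Longrightarrow> w \<noteq> z \<Longrightarrow> (d has_field_derivative g w * d w) (at w)"
    and "d z = 0" "w \<in> ball z r"
  shows "d w = 0"
proof -
  have z: "z \<in> ball z r"
    using assms(5) le_less_trans[OF zero_le_dist[of z w]] by simp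
  have cont: "isCont f z" if "f holomorphic_on ball z r" for f
    using that z by (meson continuous_on_eq_continuous_at holomorphic_on_imp_continuous_on open_ball)
  have "deriv d z = g z * d z"
  proof (rule isCont_eqI[where f = "deriv d" and g = "\<lambda>w. g w * d w"])
    show "isCont (deriv d) z" using d by (intro cont holomorphic_deriv) auto
    show "isCont (\<lambda>w. g w * d w) z" using cont[OF d] cont[OF g] by simp
    have "\<forall>\<^sub>F w in at z. w \<in> ball z r" using z by (intro eventually_at_in_open') auto
    moreover have "\<forall>\<^sub>F w in at z. w \<noteq> z" by (simp add: eventually_at_filter)
    ultimately show "\<forall>\<^sub>F w in at z. deriv d w = g w * d w"
      by eventually_elim (simp add: DERIV_imp_deriv ode)
  qed
  then have d': "(d has_field_derivative g w * d w) (at w)" if "w \<in> ball z r" for w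
    using ode[OF that] holomorphic_derivI[OF d open_ball z] by (cases "w = z") auto
  obtain G where G: "\<And>w. w \<in> ball z r \<Longrightarrow> (G has_field_derivative g w) (at w)"
    using holomorphic_convex_primitive'[OF convex_ball open_ball g] by (metis at_within_open open_ball)
  have "\<exists>c. \<forall>w\<in>ball z r. d w * exp (- G w) = c"
  proof (rule has_field_derivative_zero_constant)
    fix w assume w: "w \<in> ball z r"
    have "((\<lambda>w. d w * exp (- G w)) has_field_derivative 0) (at w)"
      by (rule derivative_eq_intros d' G refl w | simp)+
    then show "((\<lambda>w. d w * exp (- G w)) has_field_derivative 0) (at w within ball z r)"
      by (rule has_field_derivative_at_within)
  qed auto
  then have "d w * exp (- G w) = d z * exp (- G z)"
    using z assms(5) by metis
  then show ?thesis using assms(4) by simp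
qed

section \<open>Functions that are rational off a finite set\<close>

lemma eventually_at_if_cofinite: "eventually P cofinite \<Longrightarrow> eventually P (at (z :: complex))"
proof -
  assume "eventually P cofinite"
  then have fin: "finite {x. \<not> P x}"
    by (simp add: eventually_cofinite)
  then have "open (- ({x. \<not> P x} - {z}))" by (intro open_Compl finite_imp_closed) auto
  then have "\<forall>\<^sub>F w in at z. w \<in> - ({x. \<not> P x} - {z}) - {z}" by (rule eventually_at_in_open) auto
  then show ?thesis by eventually_elim auto
qed

lemma cofinite_deriv_cong:
  assumes "\<forall>\<^sub>\<infinity>z. f z = (g z :: complex)"
  shows "\<forall>\<^sub>\<infinity>z. deriv f z = deriv g z"
proof -
  have op: "open {z. f z = g z}"
    using assms by (auto simp: eventually_cofinite open_closed Compl_eq Collect_neg_eq[symmetric] intro: finite_imp_closed)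
  have "deriv f z = deriv g z" if "f z = g z" for z
  proof (rule deriv_cong_ev)
    show "\<forall>\<^sub>F x in nhds z. f x = g x"
      using op that by (auto simp: eventually_nhds)
  qed simp
  with assms show ?thesis by (auto elim: eventually_mono)
qed

text \<open>
  Agreement with a quotient of polynomials off a finite set.  It ignores the values at poles and
  removable singularities, and hence is closed under the field operations; \<open>rational_fun\<close>, which
  fixes these values by lowest terms, is not.
\<close>

definition almost_rational :: "(complex \<Rightarrow> complex) \<Rightarrow> bool" where
  "almost_rational f \<longleftrightarrow> (\<exists>r s. s \<noteq> 0 \<and> (\<forall>\<^sub>\<infinity>z. f z = poly r z / poly s z))"

lemma cofinite_poly_nonzero: "s \<noteq> 0 \<Longrightarrow> \<forall>\<^sub>\<infinity>z. poly s (z :: complex) \<noteq> 0"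
  by (simp add: eventually_cofinite poly_roots_finite)

lemma almost_rational_transform:
  assumes "almost_rational f" "\<forall>\<^sub>\<infinity>z. g z = f z"
  shows "almost_rational g"
proof -
  obtain r s where rs: "s \<noteq> 0" "\<forall>\<^sub>\<infinity>z. f z = poly r z / poly s z"
    using assms(1) unfolding almost_rational_def by blast
  have "\<forall>\<^sub>\<infinity>z. g z = poly r z / poly s z"
    using assms(2) rs(2) by eventually_elim simp
  with rs(1) show ?thesis unfolding almost_rational_def by blast
qed

lemma almost_rational_const: "almost_rational (\<lambda>z. a)"
  unfolding almost_rational_def by (rule exI[of _ "[:a:]"], rule exI[of _ 1]) simp

lemma almost_rational_ident: "almost_rational (\<lambda>z. z)"
  unfolding almost_rational_def by (rule exI[of _ "[:0, 1:]"], rule exI[of _ 1]) simp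

lemma almost_rational_add:
  assumes "almost_rational f" "almost_rational g"
  shows "almost_rational (\<lambda>z. f z + g z)"
proof -
  obtain r s where rs: "s \<noteq> 0" "\<forall>\<^sub>\<infinity>z. f z = poly r z / poly s z"
    using assms(1) unfolding almost_rational_def by blast
  obtain r' s' where rs': "s' \<noteq> 0" "\<forall>\<^sub>\<infinity>z. g z = poly r' z / poly s' z"
    using assms(2) unfolding almost_rational_def by blast
  have "\<forall>\<^sub>\<infinity>z. f z + g z = poly (r * s' + r' * s) z / poly (s * s') z"
    using rs(2) rs'(2) cofinite_poly_nonzero[OF rs(1)] cofinite_poly_nonzero[OF rs'(1)]
    by eventually_elim (simp add: field_simps)
  with rs(1) rs'(1) show ?thesis unfolding almost_rational_def by (metis no_zero_divisors)
qed

lemma almost_rational_mult: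
  assumes "almost_rational f" "almost_rational g"
  shows "almost_rational (\<lambda>z. f z * g z)"
proof -
  obtain r s where rs: "s \<noteq> 0" "\<forall>\<^sub>\<infinity>z. f z = poly r z / poly s z"
    using assms(1) unfolding almost_rational_def by blast
  obtain r' s' where rs': "s' \<noteq> 0" "\<forall>\<^sub>\<infinity>z. g z = poly r' z / poly s' z"
    using assms(2) unfolding almost_rational_def by blast
  have "\<forall>\<^sub>\<infinity>z. f z * g z = poly (r * r') z / poly (s * s') z"
    using rs(2) rs'(2) by eventually_elim simp
  with rs(1) rs'(1) show ?thesis unfolding almost_rational_def by (metis no_zero_divisors)
qed

lemma almost_rational_uminus: "almost_rational f \<Longrightarrow> almost_rational (\<lambda>z. - f z)"
  using almost_rational_mult[OF almost_rational_const[of "-1"], of f] by simp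

lemma almost_rational_inverse:
  assumes "almost_rational f"
  shows "almost_rational (\<lambda>z. inverse (f z))"
proof -
  obtain r s where rs: "s \<noteq> 0" "\<forall>\<^sub>\<infinity>z. f z = poly r z / poly s z"
    using assms unfolding almost_rational_def by blast
  show ?thesis
  proof (cases "r = 0")
    case True
    have "\<forall>\<^sub>\<infinity>z. inverse (f z) = 0"
      using rs(2) by eventually_elim (simp add: True)
    then show ?thesis
      by (rule almost_rational_transform[OF almost_rational_const])
  next
    case False
    have "\<forall>\<^sub>\<infinity>z. inverse (f z) = poly s z / poly r z"
      using rs(2) by eventually_elim simp
    with False show ?thesis unfolding almost_rational_def by blast
  qed
qed

lemma almost_rational_divide:
  "almost_rational f \<Longrightarrow> almost_rational g \<Longrightarrow> almost_rational (\<lambda>z. f z / g z)"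
  unfolding divide_inverse by (intro almost_rational_mult almost_rational_inverse)

lemma almost_rational_sum:
  "(\<And>i. i \<in> I \<Longrightarrow> almost_rational (f i)) \<Longrightarrow> almost_rational (\<lambda>z. \<Sum>i\<in>I. f i z)"
  by (induction I rule: infinite_finite_induct)
    (auto intro: almost_rational_const almost_rational_add)

lemma almost_rational_prod:
  "(\<And>i. i \<in> I \<Longrightarrow> almost_rational (f i)) \<Longrightarrow> almost_rational (\<lambda>z. \<Prod>i\<in>I. f i z)"
  by (induction I rule: infinite_finite_induct)
    (auto intro: almost_rational_const almost_rational_mult)

lemma almost_rational_poly: "almost_rational f \<Longrightarrow> almost_rational (\<lambda>z. poly q (f z))"
  by (induction q) (auto intro: almost_rational_const almost_rational_add almost_rational_mult)

lemma almost_rational_det: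
  fixes A :: "complex \<Rightarrow> complex ^ 'n::finite ^ 'n"
  assumes "\<And>i j. almost_rational (\<lambda>z. A z $ i $ j)"
  shows "almost_rational (\<lambda>z. det (A z))"
  unfolding det_def
  by (intro almost_rational_sum almost_rational_mult almost_rational_const almost_rational_prod assms)

lemma almost_rational_matrix_inv:
  fixes A :: "complex \<Rightarrow> complex ^ 'n::finite ^ 'n"
  assumes "\<And>i j. almost_rational (\<lambda>z. A z $ i $ j)"
    and "\<forall>\<^sub>\<infinity>z. det (A z) \<noteq> 0"
  shows "almost_rational (\<lambda>z. matrix_inv (A z) $ i $ j)"
proof -
  have "almost_rational (\<lambda>z. (\<chi> k l. if l = i then (axis j 1 :: complex ^ 'n) $ k else A z $ k $ l) $ k $ l)" for k l
    using assms(1)[of k l] almost_rational_const by (cases "l = i") auto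
  then have "almost_rational (\<lambda>z. det (\<chi> k l. if l = i then (axis j 1 :: complex ^ 'n) $ k else A z $ k $ l) / det (A z))"
    by (intro almost_rational_divide almost_rational_det assms)
  then show ?thesis
  proof (rule almost_rational_transform)
    show "\<forall>\<^sub>\<infinity>z. matrix_inv (A z) $ i $ j = det (\<chi> k l. if l = i then (axis j 1 :: complex ^ 'n) $ k else A z $ k $ l) / det (A z)"
      using assms(2) by eventually_elim (rule matrix_inv_entry)
  qed
qed

lemma almost_rational_lowest_terms:
  assumes "almost_rational f"
  shows "\<exists>g. rational_fun g \<and> (\<forall>\<^sub>\<infinity>z. g z = f z)"
proof -
  obtain r s where rs: "s \<noteq> 0" "\<forall>\<^sub>\<infinity>z. f z = poly r z / poly s z"
    using assms unfolding almost_rational_def by blast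
  then obtain r' s' where rs': "r = r' * gcd r s" "s = s' * gcd r s" "coprime r' s'"
    using gcd_coprime_exists[of r s] by auto
  have "s' \<noteq> 0" "gcd r s \<noteq> 0" using rs(1) rs'(2) by auto
  have "\<forall>\<^sub>\<infinity>z. poly r' z / poly s' z = f z"
    using rs(2) cofinite_poly_nonzero[OF \<open>gcd r s \<noteq> 0\<close>]
    by eventually_elim (subst (asm) rs'(1), subst (asm) (2) rs'(2), simp)
  with rs'(3) \<open>s' \<noteq> 0\<close> show ?thesis unfolding rational_fun_def by blast
qed

text \<open>
  In lowest terms a zero of the denominator is not a zero of the numerator, so it is a pole.
\<close>

lemma rational_fun_holomorphic_or_pole:
  assumes "rational_fun f" "\<not> is_pole f z"
  shows "\<exists>r>0. f holomorphic_on ball z r"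
proof -
  obtain r s where rs: "s \<noteq> 0" "coprime r s" "f = (\<lambda>z. poly r z / poly s z)"
    using assms(1) unfolding rational_fun_def by blast
  have "poly s z \<noteq> 0"
  proof
    assume s0: "poly s z = 0"
    have r0: "poly r z \<noteq> 0"
    proof -
      have "\<not> [:- z, 1:] dvd r"
      proof
        assume "[:- z, 1:] dvd r"
        moreover have "[:- z, 1:] dvd s" using s0 by (simp add: poly_eq_0_iff_dvd)
        ultimately have "is_unit [:- z, 1:]" using rs(2) by (rule coprime_common_divisor[rotated])
        then show False by (simp add: is_unit_pCons_iff)
      qed
      then show ?thesis by (simp add: poly_eq_0_iff_dvd)
    qed
    have "is_pole f z"
      unfolding is_pole_def rs(3)
    proof (rule filterlim_divide_at_infinity)
      show "(poly r \<longlongrightarrow> poly r z) (at z)" by (intro tendsto_intros)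
      show "filterlim (poly s) (at 0) (at z)"
        unfolding filterlim_at
      proof
        show "(poly s \<longlongrightarrow> 0) (at z)" using tendsto_poly[OF tendsto_ident_at, of s z UNIV] s0 by simp
        show "\<forall>\<^sub>F w in at z. poly s w \<in> UNIV \<and> poly s w \<noteq> 0"
          using eventually_at_if_cofinite[OF cofinite_poly_nonzero[OF rs(1)]] by simp
      qed
    qed (use r0 in auto)
    with assms(2) show False by simp
  qed
  moreover have "open {w. poly s w \<noteq> 0}"
    by (intro open_Collect_neq continuous_intros)
  ultimately obtain \<epsilon> where e: "\<epsilon> > 0" "ball z \<epsilon> \<subseteq> {w. poly s w \<noteq> 0}"
    by (auto simp: open_contains_ball)
  then have "f holomorphic_on ball z \<epsilon>"
    unfolding rs(3) by (intro holomorphic_intros) auto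
  with e(1) show ?thesis by blast
qed


section \<open>The cyclic frame and the degree of its determinant\<close>

text \<open>
  \<open>U\<close> and \<open>\<mu>\<close> are the matrices of the system at one point of the manifold and \<open>u\<close> is the index of the
  unit field.  The bijection \<open>pos\<close> numbers the unordered index type by \<open>0, \<dots>, n - 1\<close>, so that the
  vectors \<open>e\<^sub>0, \<dots>, e\<^sub>n\<^sub>-\<^sub>1\<close> can be the rows of a square matrix.
\<close>

locale cyclic_system =
  fixes U \<mu> :: "complex ^ 'n::finite ^ 'n" and u :: 'n and pos :: "'n \<Rightarrow> nat"
  assumes diag: "\<And>i j. i \<noteq> j \<Longrightarrow> \<mu> $ i $ j = 0"
    and pos: "bij_betw pos UNIV {..<CARD('n)}"
begin

definition A :: "complex \<Rightarrow> complex ^ 'n ^ 'n" where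
  "A z = (\<chi> i j. transpose U $ i $ j - (1 / z) * \<mu> $ i $ j)"

text \<open>
  The vector \<open>e\<^sub>k\<close> is polynomial in \<open>w = 1/z\<close>, and these are the polynomials.  The recursion is
  \<open>e\<^sub>k\<^sub>+\<^sub>1 = \<partial>\<^sub>z e\<^sub>k + U e\<^sub>k - w \<mu> e\<^sub>k\<close> for a diagonal \<open>\<mu>\<close>, with \<open>\<partial>\<^sub>z = - w\<^sup>2 \<partial>\<^sub>w\<close>.
\<close>

primrec cyc_poly :: "nat \<Rightarrow> 'n \<Rightarrow> complex poly" where
  "cyc_poly 0 i = (if i = u then 1 else 0)"
| "cyc_poly (Suc k) i = (\<Sum>j\<in>UNIV. smult (U $ i $ j) (cyc_poly k j))
     - pCons 0 (smult (\<mu> $ i $ i) (cyc_poly k i)) - pCons 0 (pCons 0 (pderiv (cyc_poly k i)))"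

definition cyc :: "nat \<Rightarrow> complex \<Rightarrow> 'n \<Rightarrow> complex" where
  "cyc k z i = poly (cyc_poly k i) (1 / z)"

definition frame :: "complex \<Rightarrow> complex ^ 'n ^ 'n" where
  "frame z = (\<chi> k i. cyc (pos k) z i)"

definition frame_det_poly :: "complex poly" where
  "frame_det_poly = det (\<chi> k i. cyc_poly (pos k) i)"

definition companion :: "(nat \<Rightarrow> complex) \<Rightarrow> complex ^ 'n ^ 'n" where
  "companion a = (\<chi> k l. if Suc (pos k) < CARD('n) then (if pos l = Suc (pos k) then 1 else 0) else - a (pos l))"

lemma pos_less: "pos k < CARD('n)"
  using pos by (auto simp: bij_betw_def)

lemma sum_pos: "(\<Sum>k\<in>UNIV. f (pos k)) = (\<Sum>j<CARD('n). f j)"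
  using sum.reindex_bij_betw[OF pos] .

lemma pos_inv: "j < CARD('n) \<Longrightarrow> pos (inv pos j) = j"
  using pos by (intro f_inv_into_f) (auto simp: bij_betw_def)

lemma inv_pos: "inv pos (pos k) = k"
  using pos by (intro inv_f_f) (auto simp: bij_betw_def)

lemma cyc_0: "cyc 0 z i = (if i = u then 1 else 0)"
  by (simp add: cyc_def)

lemma cyc_has_field_derivative:
  assumes "z \<noteq> 0"
  shows "((\<lambda>z. cyc k z i) has_field_derivative
           cyc (Suc k) z i - (\<Sum>j\<in>UNIV. cyc k z j * A z $ j $ i)) (at z)"
proof -
  have "(\<Sum>j\<in>UNIV. cyc k z j * A z $ j $ i)
      = (\<Sum>j\<in>UNIV. U $ i $ j * cyc k z j) - (\<Sum>j\<in>UNIV. (1 / z) * (\<mu> $ j $ i * cyc k z j))"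
    by (simp add: A_def transpose_def algebra_simps sum_subtractf)
  also have "(\<Sum>j\<in>UNIV. (1 / z) * (\<mu> $ j $ i * cyc k z j)) = (1 / z) * (\<mu> $ i $ i * cyc k z i)"
    by (subst sum.remove[of _ i]) (auto simp: diag)
  finally have "cyc (Suc k) z i - (\<Sum>j\<in>UNIV. cyc k z j * A z $ j $ i)
      = poly (pderiv (cyc_poly k i)) (1 / z) * - (1 / z ^ 2)"
    by (simp add: cyc_def poly_sum power2_eq_square)
  moreover have "((\<lambda>z. cyc k z i) has_field_derivative poly (pderiv (cyc_poly k i)) (1 / z) * - (1 / z ^ 2)) (at z)"
    unfolding cyc_def
    by (rule DERIV_chain2[OF poly_DERIV]) (auto intro!: derivative_eq_intros simp: assms power2_eq_square)
  ultimately show ?thesis by simp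
qed

lemma cyc_holomorphic:
  assumes "0 \<notin> S"
  shows "(\<lambda>z. cyc k z i) holomorphic_on S"
  unfolding holomorphic_on_def
proof
  fix z assume "z \<in> S"
  then have "z \<noteq> 0" using assms by blast
  then show "(\<lambda>z. cyc k z i) field_differentiable at z within S"
    using cyc_has_field_derivative has_field_derivative_at_within
    unfolding field_differentiable_def by blast
qed

lemma frame_holomorphic: "0 \<notin> S \<Longrightarrow> (\<lambda>z. frame z $ k $ i) holomorphic_on S"
  by (simp add: frame_def cyc_holomorphic)

text \<open>
  Passing from \<open>e\<^sub>k\<close> to \<open>e\<^sub>k\<^sub>+\<^sub>1\<close> raises the degree in \<open>1/z\<close> by at most one, but the new top coefficient
  is \<open>- (k + \<mu>)\<close> applied to the old one.  Since \<open>e\<^sub>0\<close> is the basis vector \<open>u\<close>, an eigenvector of \<open>\<mu>\<close>,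
  the top coefficient stays a multiple of it, and every other component loses one degree.
\<close>

lemma coeff_cyc_poly:
  "(i \<noteq> u \<longrightarrow> k \<le> m \<longrightarrow> coeff (cyc_poly k i) m = 0) \<and> (k < m \<longrightarrow> coeff (cyc_poly k i) m = 0)"
proof (induction k arbitrary: i m)
  case 0
  show ?case by (auto simp: coeff_eq_0)
next
  case (Suc k)
  have "coeff (cyc_poly (Suc k) i) m = 0" if "i \<noteq> u \<and> Suc k \<le> m \<or> Suc k < m"
  proof -
    from that have "m \<noteq> 0" by auto
    then obtain m' where m: "m = Suc m'" using not0_implies_Suc by blast
    have "coeff (cyc_poly k j) m = 0" for j
      using Suc.IH that by auto
    moreover have m': "coeff (cyc_poly k i) m' = 0"
      using Suc.IH that m by auto
    moreover have "coeff (pCons 0 (pderiv (cyc_poly k i))) m' = 0"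
      using m' by (cases m') (auto simp: coeff_pderiv)
    ultimately show ?thesis by (simp add: m coeff_sum)
  qed
  then show ?case by auto
qed

lemma degree_cyc_poly: "i \<noteq> u \<Longrightarrow> degree (cyc_poly k i) \<le> k - 1"
  using coeff_cyc_poly[of i k] by (intro degree_le) auto

lemma poly_frame_det_poly: "poly frame_det_poly (1 / z) = det (frame z)"
  by (simp add: frame_det_poly_def frame_def cyc_def det_def poly_sum poly_prod)

text \<open>
  The row of \<open>e\<^sub>0\<close> has its only nonzero entry in column \<open>u\<close>, so the other rows contribute entries
  outside that column, the one from \<open>e\<^sub>k\<close> of degree at most \<open>k - 1\<close>.  The sum of \<open>k - 1\<close> over
  \<open>0 < k < n\<close> is \<open>(n - 1) choose 2\<close>.
\<close>

lemma degree_frame_det_poly: "degree frame_det_poly \<le> (CARD('n) - 1) choose 2"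
  unfolding frame_det_poly_def det_def
proof (rule degree_sum_le)
  fix p :: "'n \<Rightarrow> 'n" assume "p \<in> {p. p permutes UNIV}"
  then have p: "inj p" using permutes_inj by blast
  define k0 where "k0 = inv pos 0"
  have k0: "pos k0 = 0" by (simp add: k0_def pos_inv)
  let ?M = "(\<chi> k i. cyc_poly (pos k) i) :: complex poly ^ 'n ^ 'n"
  show "degree (of_int (sign p) * (\<Prod>k\<in>UNIV. ?M $ k $ p k)) \<le> (CARD('n) - 1) choose 2"
  proof (cases "p k0 = u")
    case False
    then have "(\<Prod>k\<in>UNIV. ?M $ k $ p k) = 0"
      by (intro prod_zero) (auto intro!: exI[of _ k0] simp: k0)
    then show ?thesis by (simp only: mult_zero_right degree_0 le0)
  next
    case True
    \<comment> \<open>For \<open>k = k0\<close> the entry is the constant \<open>1\<close>, and truncated subtraction gives \<open>0 - 1 = 0\<close>.\<close>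
    have deg: "degree (?M $ k $ p k) \<le> pos k - 1" for k
    proof (cases "k = k0")
      case False
      then have "p k \<noteq> u" using True p by (metis injD)
      then show ?thesis using degree_cyc_poly[of "p k" "pos k"] by simp
    qed (simp add: k0 True)
    have "degree (of_int (sign p) * (\<Prod>k\<in>UNIV. ?M $ k $ p k))
        \<le> degree (of_int (sign p) :: complex poly) + degree (\<Prod>k\<in>UNIV. ?M $ k $ p k)"
      by (rule degree_mult_le)
    also have "\<dots> = degree (\<Prod>k\<in>UNIV. ?M $ k $ p k)" by simp
    also have "\<dots> \<le> (\<Sum>k\<in>UNIV. degree (?M $ k $ p k))"
      using degree_prod_sum_le[of UNIV "\<lambda>k. ?M $ k $ p k"] by (simp add: o_def)
    also have "\<dots> \<le> (\<Sum>k\<in>UNIV. pos k - 1)" by (intro sum_mono deg)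
    also have "\<dots> = (\<Sum>j<CARD('n). j - 1)" by (rule sum_pos)
    also have "\<dots> = (CARD('n) - 1) choose 2"
    proof -
      have "(\<Sum>j<Suc l. j - 1) = l choose 2" for l
        by (induction l) (auto simp: numeral_2_eq_2)
      from this[of "CARD('n) - 1"] show ?thesis by simp
    qed
    finally show ?thesis .
  qed
qed (simp add: finite_permutations)

lemma degenerate_points:
  assumes "frame_det_poly \<noteq> 0"
  shows "finite {z. z \<noteq> 0 \<and> det (frame z) = 0}"
    and "card {z. z \<noteq> 0 \<and> det (frame z) = 0} \<le> (CARD('n) - 1) choose 2"
proof -
  let ?Z = "{z. z \<noteq> 0 \<and> det (frame z) = 0}" and ?R = "{w. poly frame_det_poly w = 0}"
  have sub: "(\<lambda>z. 1 / z) ` ?Z \<subseteq> ?R" by (auto simp: poly_frame_det_poly)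
  have inj: "inj_on (\<lambda>z. 1 / z) ?Z" by (auto simp: inj_on_def)
  have fin: "finite ?R" by (rule poly_roots_finite[OF assms])
  show "finite ?Z" using inj_on_finite[OF inj sub fin] .
  have "card ?Z \<le> card ?R" by (rule card_inj_on_le[OF inj sub fin])
  also have "\<dots> \<le> degree frame_det_poly" by (rule card_poly_roots_bound[OF assms])
  also have "\<dots> \<le> (CARD('n) - 1) choose 2" by (rule degree_frame_det_poly)
  finally show "card ?Z \<le> (CARD('n) - 1) choose 2" .
qed

lemma cofinite_nondegenerate:
  assumes "frame_det_poly \<noteq> 0"
  shows "\<forall>\<^sub>\<infinity>z. z \<noteq> 0 \<and> det (frame z) \<noteq> 0"
proof -
  have "{z. \<not> (z \<noteq> 0 \<and> det (frame z) \<noteq> 0)} \<subseteq> insert 0 {z. z \<noteq> 0 \<and> det (frame z) = 0}" by auto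
  then show ?thesis
    unfolding eventually_cofinite using degenerate_points(1)[OF assms] by (auto intro: finite_subset)
qed


section \<open>The scalar equation and its singular points\<close>

text \<open>
  For a solution \<open>\<xi>\<close> of the system the \<open>k\<close>-th derivative of \<open>y = \<xi>\<^sub>u\<close> is \<open>\<langle>\<xi>, e\<^sub>k\<rangle>\<close>, and the values of \<open>\<xi>\<close>
  at \<open>z\<close> are arbitrary.  The scalar equation thus amounts to \<open>e\<^sub>n + a\<^sub>n\<^sub>-\<^sub>1 e\<^sub>n\<^sub>-\<^sub>1 + \<dots> + a\<^sub>0 e\<^sub>0 = 0\<close>.
\<close>

definition relation_at :: "(nat \<Rightarrow> complex) \<Rightarrow> complex \<Rightarrow> bool" where
  "relation_at a z \<longleftrightarrow> (\<forall>i. cyc CARD('n) z i = - (\<Sum>j<CARD('n). a j * cyc j z i))"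

text \<open>
  The solution of this linear system for \<open>a\<close>, meaningful where the frame is nondegenerate.
\<close>

definition coef :: "nat \<Rightarrow> complex \<Rightarrow> complex" where
  "coef j z = - (\<Sum>i\<in>UNIV. cyc CARD('n) z i * matrix_inv (frame z) $ i $ inv pos j)"

lemma vector_matrix_frame: "((\<chi> k. x (pos k)) v* frame z) $ i = (\<Sum>j<CARD('n). x j * cyc j z i)"
  using sum_pos[of "\<lambda>j. x j * cyc j z i"]
  by (simp add: vector_matrix_mult_def frame_def mult.commute)

lemma relation_iff_coef:
  assumes "det (frame z) \<noteq> 0"
  shows "relation_at a z \<longleftrightarrow> (\<forall>j<CARD('n). a j = coef j z)"
proof -
  let ?x = "(\<chi> k. a (pos k)) :: complex ^ 'n" and ?b = "(\<chi> i. - cyc CARD('n) z i) :: complex ^ 'n"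
  note inv = matrix_inv_mult[OF assms]
  have "relation_at a z \<longleftrightarrow> ?x v* frame z = ?b"
    by (auto simp: relation_at_def vec_eq_iff vector_matrix_frame minus_equation_iff)
  also have "\<dots> \<longleftrightarrow> ?x = ?b v* matrix_inv (frame z)"
    by (metis inv vector_matrix_mul_assoc vector_matrix_mul_rid)
  also have "\<dots> \<longleftrightarrow> (\<forall>k. a (pos k) = coef (pos k) z)"
    by (simp add: vec_eq_iff coef_def vector_matrix_mult_def inv_pos sum_negf mult.commute)
  also have "\<dots> \<longleftrightarrow> (\<forall>j<CARD('n). a j = coef j z)"
    using pos by (metis pos_inv pos_less)
  finally show ?thesis .
qed

lemma coef_holomorphic:
  assumes "0 \<notin> S" "\<And>z. z \<in> S \<Longrightarrow> det (frame z) \<noteq> 0"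
  shows "coef j holomorphic_on S"
  unfolding coef_def
  by (intro holomorphic_intros cyc_holomorphic holomorphic_on_matrix_inv frame_holomorphic assms)

lemma companion_mult:
  assumes "x CARD('n) = - (\<Sum>j<CARD('n). a j * x j)"
  shows "(\<Sum>l\<in>UNIV. companion a $ k $ l * x (pos l)) = x (Suc (pos k))"
proof -
  have "(\<Sum>l\<in>UNIV. companion a $ k $ l * x (pos l))
      = (\<Sum>j<CARD('n). (if Suc (pos k) < CARD('n) then (if j = Suc (pos k) then 1 else 0) else - a j) * x j)"
    by (simp add: companion_def flip: sum_pos)
  also have "\<dots> = x (Suc (pos k))"
  proof (cases "Suc (pos k) < CARD('n)")
    case False
    then have "Suc (pos k) = CARD('n)" using pos_less[of k] by simp
    then show ?thesis using assms by (simp add: sum_negf)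
  qed (simp add: if_distrib[of "\<lambda>y. y * _"] cong: if_cong)
  finally show ?thesis .
qed

text \<open>
  The frame is the gauge transformation from the system to the companion system.
\<close>

lemma frame_has_field_derivative:
  assumes "z \<noteq> 0" "relation_at a z"
  shows "((\<lambda>z. frame z $ k $ i) has_field_derivative
            (companion a ** frame z - frame z ** A z) $ k $ i) (at z)"
proof -
  have "(companion a ** frame z) $ k $ i = cyc (Suc (pos k)) z i"
    using companion_mult[of "\<lambda>j. cyc j z i" a k] assms(2)
    by (simp add: relation_at_def matrix_matrix_mult_def frame_def)
  then have "(companion a ** frame z - frame z ** A z) $ k $ i
      = cyc (Suc (pos k)) z i - (\<Sum>j\<in>UNIV. cyc (pos k) z j * A z $ j $ i)"
    by (simp add: matrix_matrix_mult_def[of "frame z"]) (simp add: frame_def)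
  then show ?thesis
    using cyc_has_field_derivative[OF assms(1), of "pos k" i] by (simp add: frame_def)
qed

text \<open>
  The scalar equation cannot be regular at a point of \<open>\<complex>\<^sup>*\<close> where the frame degenerates.  By
  Liouville's formula the determinant of the frame satisfies \<open>d' = (tr C - tr A) d\<close> near such a
  point, with holomorphic coefficient, so that vanishing at the point would make it vanish nearby,
  where the frame is known to be nondegenerate.
\<close>

lemma nondegenerate_if_regular:
  assumes "z \<noteq> 0" "r > 0" and nz: "frame_det_poly \<noteq> 0"
    and hol: "\<And>j. j < CARD('n) \<Longrightarrow> a j holomorphic_on ball z r"
    and rel: "\<forall>\<^sub>\<infinity>w. relation_at (\<lambda>j. a j w) w"
  shows "relation_at (\<lambda>j. a j z) z" and "det (frame z) \<noteq> 0"
proof -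
  have cont: "isCont (a j) z" if "j < CARD('n)" for j
    using hol[OF that] assms(2)
    by (meson centre_in_ball continuous_on_eq_continuous_at holomorphic_on_imp_continuous_on open_ball)
  have contc: "isCont (\<lambda>w. cyc j w i) z" for i j
    using cyc_has_field_derivative[OF assms(1)] DERIV_isCont by blast
  show rel_z: "relation_at (\<lambda>j. a j z) z"
    unfolding relation_at_def
  proof
    fix i
    have "isCont (\<lambda>w. - (\<Sum>j<CARD('n). a j w * cyc j w i)) z"
      by (intro continuous_intros cont contc) auto
    moreover have "\<forall>\<^sub>F w in at z. cyc CARD('n) w i = - (\<Sum>j<CARD('n). a j w * cyc j w i)"
      using eventually_at_if_cofinite[OF rel] by eventually_elim (simp add: relation_at_def)
    ultimately show "cyc CARD('n) z i = - (\<Sum>j<CARD('n). a j z * cyc j z i)"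
      using isCont_eqI[OF contc] by blast
  qed
  have "\<forall>\<^sub>F w in at z. w \<noteq> 0 \<and> det (frame w) \<noteq> 0 \<and> relation_at (\<lambda>j. a j w) w"
    using eventually_at_if_cofinite[OF rel] eventually_at_if_cofinite[OF cofinite_nondegenerate[OF nz]]
    by eventually_elim auto
  then obtain \<epsilon> where e: "\<epsilon> > 0"
    "\<And>w. w \<noteq> z \<Longrightarrow> dist w z < \<epsilon> \<Longrightarrow> w \<noteq> 0 \<and> det (frame w) \<noteq> 0 \<and> relation_at (\<lambda>j. a j w) w"
    unfolding eventually_at by auto
  define \<delta> where "\<delta> = min r \<epsilon>"
  have d: "\<delta> > 0" "ball z \<delta> \<subseteq> ball z r" using e(1) assms(2) by (auto simp: \<delta>_def)
  have B: "w \<noteq> 0 \<and> det (frame w) \<noteq> 0 \<and> relation_at (\<lambda>j. a j w) w" if "w \<in> ball z \<delta>" "w \<noteq> z" for w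
    using e(2)[of w] that by (auto simp: \<delta>_def dist_commute)
  then have 0: "0 \<notin> ball z \<delta>" using assms(1) by blast
  let ?g = "\<lambda>w. trace (companion (\<lambda>j. a j w)) - trace (A w)"
  have "companion (\<lambda>j. a j w) $ k $ k = (if Suc (pos k) < CARD('n) then 0 else - a (pos k) w)" for k w
    by (simp add: companion_def)
  then have "(\<lambda>w. companion (\<lambda>j. a j w) $ k $ k) holomorphic_on ball z \<delta>" for k
    using holomorphic_on_subset[OF hol[OF pos_less] d(2), of k]
    by (cases "Suc (pos k) < CARD('n)") (simp_all add: holomorphic_on_minus)
  moreover have "(\<lambda>w. A w $ k $ k) holomorphic_on ball z \<delta>" for k
    unfolding A_def using 0 by (auto intro!: holomorphic_intros)
  ultimately have g: "?g holomorphic_on ball z \<delta>"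
    unfolding trace_def by (intro holomorphic_intros)
  have d': "(\<lambda>w. det (frame w)) holomorphic_on ball z \<delta>"
    by (intro holomorphic_on_det frame_holomorphic 0)
  show "det (frame z) \<noteq> 0"
  proof
    assume "det (frame z) = 0"
    then have *: "det (frame w) = 0" if "w \<in> ball z \<delta>" for w
      using linear_ode_zero[OF d' g _ _ that] B liouville[OF frame_has_field_derivative] by blast
    have "\<forall>\<^sub>F w in at z. w \<in> ball z \<delta> - {z}" using d(1) by (intro eventually_at_in_open) auto
    then obtain w where "w \<in> ball z \<delta> - {z}"
      using eventually_happens[of _ "at z"] by auto
    with * B show False by blast
  qed
qed

section \<open>Solutions of the system and of the scalar equation\<close>

lemma pairing_has_field_derivative:
  assumes "z \<noteq> 0" and "\<And>i. ((\<lambda>w. \<xi> w $ i) has_field_derivative (A z *v \<xi> z) $ i) (at z)"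
  shows "((\<lambda>w. \<Sum>i\<in>UNIV. \<xi> w $ i * cyc k w i) has_field_derivative
           (\<Sum>i\<in>UNIV. \<xi> z $ i * cyc (Suc k) z i)) (at z)"
proof -
  have swap: "(\<Sum>i\<in>UNIV. \<Sum>j\<in>UNIV. A z $ i $ j * \<xi> z $ j * cyc k z i)
      = (\<Sum>i\<in>UNIV. \<Sum>j\<in>UNIV. \<xi> z $ i * (cyc k z j * A z $ j $ i))"
    by (subst sum.swap) (simp add: mult_ac)
  have "((\<lambda>w. \<Sum>i\<in>UNIV. \<xi> w $ i * cyc k w i) has_field_derivative
      (\<Sum>i\<in>UNIV. (A z *v \<xi> z) $ i * cyc k z i +
        (cyc (Suc k) z i - (\<Sum>j\<in>UNIV. cyc k z j * A z $ j $ i)) * \<xi> z $ i)) (at z)"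
    by (intro DERIV_sum DERIV_mult assms cyc_has_field_derivative)
  also have "(\<Sum>i\<in>UNIV. (A z *v \<xi> z) $ i * cyc k z i +
        (cyc (Suc k) z i - (\<Sum>j\<in>UNIV. cyc k z j * A z $ j $ i)) * \<xi> z $ i)
      = (\<Sum>i\<in>UNIV. \<xi> z $ i * cyc (Suc k) z i)"
    using swap
    by (simp add: matrix_vector_mult_def sum.distrib sum_subtractf left_diff_distrib right_diff_distrib
        sum_distrib_left sum_distrib_right mult_ac)
  finally show ?thesis .
qed

text \<open>
  The covariant derivative on vectors is dual to the one for which \<open>\<xi>\<close> is flat, so each derivative
  of \<open>\<langle>\<xi>, e\<^sub>0\<rangle>\<close> falls on the vector only.
\<close>

lemma higher_deriv_first_component:
  assumes "open D" "0 \<notin> D" "\<xi> \<in> system_solutions A D"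
    and "\<And>z. z \<in> D \<Longrightarrow> y z = \<xi> z $ u" and "z \<in> D"
  shows "(deriv ^^ k) y z = (\<Sum>i\<in>UNIV. \<xi> z $ i * cyc k z i)"
  using assms(5)
proof (induction k arbitrary: z)
  case 0
  then show ?case by (simp add: assms(4) cyc_0 if_distrib cong: if_cong)
next
  case (Suc k)
  have "z \<noteq> 0" using Suc.prems assms(2) by blast
  have "(deriv ^^ Suc k) y z = deriv (\<lambda>w. \<Sum>i\<in>UNIV. \<xi> w $ i * cyc k w i) z"
  proof (simp, rule deriv_cong_ev)
    show "\<forall>\<^sub>F w in nhds z. (deriv ^^ k) y w = (\<Sum>i\<in>UNIV. \<xi> w $ i * cyc k w i)"
      using Suc.IH assms(1) Suc.prems by (auto simp: eventually_nhds)
  qed simp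
  also have "\<dots> = (\<Sum>i\<in>UNIV. \<xi> z $ i * cyc (Suc k) z i)"
    using assms(3) Suc.prems
    by (intro DERIV_imp_deriv pairing_has_field_derivative \<open>z \<noteq> 0\<close>) (simp add: system_solutions_def)
  finally show ?case .
qed

lemma frame_mult: "(frame z *v x) $ k = (\<Sum>i\<in>UNIV. x $ i * cyc (pos k) z i)"
  by (simp add: matrix_vector_mult_def frame_def mult.commute)

text \<open>
  Multiplication by the frame turns \<open>\<xi>\<close> into \<open>(y, y', \<dots>, y\<^bsup>(n-1)\<^esup>)\<close>.  Where the frame is invertible
  this determines \<open>\<xi>\<close> from \<open>y\<close>, and conversely defines a \<open>\<xi>\<close> from any solution \<open>y\<close>.  The argument
  is pointwise, so \<open>D\<close> may be any open set, connected or not.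
\<close>

lemma bij_betw_solutions:
  assumes D: "open D"
    and good: "\<And>z. z \<in> D \<Longrightarrow> z \<noteq> 0 \<and> relation_at (\<lambda>j. a j z) z \<and> det (frame z) \<noteq> 0"
  shows "bij_betw (\<lambda>\<xi>. \<lambda>z\<in>D. \<xi> z $ u) (system_solutions A D) (scalar_solutions CARD('n) a D)"
proof (rule bij_betwI')
  have 0: "0 \<notin> D" using good by blast
  note hd = higher_deriv_first_component[OF D 0]
  {
    fix \<xi> \<xi>' assume s: "\<xi> \<in> system_solutions A D" "\<xi>' \<in> system_solutions A D"
    show "((\<lambda>z\<in>D. \<xi> z $ u) = (\<lambda>z\<in>D. \<xi>' z $ u)) = (\<xi> = \<xi>')"
    proof
      assume eq: "(\<lambda>z\<in>D. \<xi> z $ u) = (\<lambda>z\<in>D. \<xi>' z $ u)"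
      show "\<xi> = \<xi>'"
      proof (rule extensionalityI)
        show "\<xi> \<in> extensional D" "\<xi>' \<in> extensional D"
          using s by (auto simp: system_solutions_def)
        fix z assume z: "z \<in> D"
        have "(\<Sum>i\<in>UNIV. \<xi> z $ i * cyc k z i) = (\<Sum>i\<in>UNIV. \<xi>' z $ i * cyc k z i)" for k
        proof -
          have "\<xi> w $ u = \<xi>' w $ u" if "w \<in> D" for w
            using fun_cong[OF eq, of w] that by simp
          then show ?thesis
            using hd[OF s(1), of "\<lambda>z. \<xi> z $ u" z k] hd[OF s(2), of "\<lambda>z. \<xi> z $ u" z k] z by simp
        qed
        then have "frame z *v \<xi> z = frame z *v \<xi>' z"
          by (simp add: vec_eq_iff frame_mult)
        then show "\<xi> z = \<xi>' z"
          using good[OF z] by (metis matrix_inv_mult(2) matrix_vector_mul_assoc matrix_vector_mul_lid)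
      qed
    qed simp
  next
    fix \<xi> assume s: "\<xi> \<in> system_solutions A D"
    let ?y = "\<lambda>z\<in>D. \<xi> z $ u"
    have "(\<lambda>z. \<xi> z $ u) holomorphic_on D"
      using s D by (auto simp: system_solutions_def holomorphic_on_open)
    then have "?y holomorphic_on D" by (rule holomorphic_transform) simp
    moreover have "(deriv ^^ CARD('n)) ?y z + (\<Sum>j<CARD('n). a j z * (deriv ^^ j) ?y z) = 0" if z: "z \<in> D" for z
    proof -
      have hd': "(deriv ^^ k) ?y z = (\<Sum>i\<in>UNIV. \<xi> z $ i * cyc k z i)" for k
        by (rule hd[OF s]) (use z in auto)
      have "(\<Sum>j<CARD('n). a j z * (\<Sum>i\<in>UNIV. \<xi> z $ i * cyc j z i))
          = (\<Sum>i\<in>UNIV. \<xi> z $ i * (\<Sum>j<CARD('n). a j z * cyc j z i))"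
        unfolding sum_distrib_left by (subst sum.swap) (simp add: mult_ac)
      also have "\<dots> = - (\<Sum>i\<in>UNIV. \<xi> z $ i * cyc CARD('n) z i)"
        using good[OF z] by (simp add: relation_at_def sum_negf)
      finally show ?thesis unfolding hd' by simp
    qed
    ultimately show "?y \<in> scalar_solutions CARD('n) a D"
      by (simp add: scalar_solutions_def)
  next
    fix y assume y: "y \<in> scalar_solutions CARD('n) a D"
    then have hol: "(deriv ^^ k) y holomorphic_on D" for k
      using D by (intro holomorphic_higher_deriv) (auto simp: scalar_solutions_def)
    define Y where "Y z = (\<chi> k. (deriv ^^ pos k) y z)" for z
    define \<xi> where "\<xi> = (\<lambda>z\<in>D. matrix_inv (frame z) *v Y z)"
    \<comment> \<open>This \<open>\<xi>\<close> is the only candidate.  Differentiating \<open>W \<xi> = Y\<close> and using \<open>W' = C W - W A\<close> and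
      \<open>Y' = C Y\<close> gives \<open>W \<xi>' = W A \<xi>\<close>.\<close>
    have frame_\<xi>: "frame z *v \<xi> z = Y z" if "z \<in> D" for z
      using good[OF that] that by (simp add: \<xi>_def matrix_vector_mul_assoc matrix_inv_mult)
    have \<xi>_hol: "(\<lambda>z. \<xi> z $ i) holomorphic_on D" for i
    proof -
      have "(\<lambda>z. \<Sum>k\<in>UNIV. matrix_inv (frame z) $ i $ k * (deriv ^^ pos k) y z) holomorphic_on D"
        using good 0 by (intro holomorphic_intros holomorphic_on_matrix_inv frame_holomorphic hol) auto
      then show ?thesis
        by (rule holomorphic_transform) (simp add: \<xi>_def Y_def matrix_vector_mult_def)
    qed
    have first: "\<xi> z $ u = y z" if "z \<in> D" for z
    proof -
      have "\<xi> z $ u = (frame z *v \<xi> z) $ inv pos 0"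
        by (simp add: frame_mult pos_inv cyc_0 if_distrib cong: if_cong)
      then show ?thesis by (simp add: frame_\<xi>[OF that] Y_def pos_inv)
    qed
    have "((\<lambda>w. \<xi> w $ i) has_field_derivative (A z *v \<xi> z) $ i) (at z)" if z: "z \<in> D" for z i
    proof -
      define \<xi>' where "\<xi>' = (\<chi> i. deriv (\<lambda>w. \<xi> w $ i) z)"
      let ?C = "companion (\<lambda>j. a j z)"
      have d\<xi>: "((\<lambda>w. \<xi> w $ i) has_field_derivative \<xi>' $ i) (at z)" for i
        using holomorphic_derivI[OF \<xi>_hol D z] by (simp add: \<xi>'_def)
      have "(?C *v Y z) $ k = ((?C ** frame z - frame z ** A z) *v \<xi> z + frame z *v \<xi>') $ k" for k
      proof -
        have "(deriv ^^ CARD('n)) y z = - (\<Sum>j<CARD('n). a j z * (deriv ^^ j) y z)"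
          using y z by (simp add: scalar_solutions_def eq_neg_iff_add_eq_0)
        then have "(?C *v Y z) $ k = (deriv ^^ Suc (pos k)) y z"
          using companion_mult[of "\<lambda>j. (deriv ^^ j) y z"] by (simp add: matrix_vector_mult_def Y_def)
        then have "((\<lambda>w. Y w $ k) has_field_derivative (?C *v Y z) $ k) (at z)"
          using holomorphic_derivI[OF hol D z] by (simp add: Y_def)
        moreover have "((\<lambda>w. \<Sum>i\<in>UNIV. frame w $ k $ i * \<xi> w $ i) has_field_derivative
            (\<Sum>i\<in>UNIV. (?C ** frame z - frame z ** A z) $ k $ i * \<xi> z $ i + \<xi>' $ i * frame z $ k $ i)) (at z)"
          using good[OF z] by (intro DERIV_sum DERIV_mult d\<xi> frame_has_field_derivative) auto
        then have "((\<lambda>w. Y w $ k) has_field_derivative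
            (\<Sum>i\<in>UNIV. (?C ** frame z - frame z ** A z) $ k $ i * \<xi> z $ i + \<xi>' $ i * frame z $ k $ i)) (at z)"
        proof (rule has_field_derivative_transform_within_open[OF _ D z])
          fix w assume "w \<in> D"
          then show "(\<Sum>i\<in>UNIV. frame w $ k $ i * \<xi> w $ i) = Y w $ k"
            by (simp flip: frame_\<xi>) (simp add: matrix_vector_mult_def)
        qed
        ultimately have "(?C *v Y z) $ k =
            (\<Sum>i\<in>UNIV. (?C ** frame z - frame z ** A z) $ k $ i * \<xi> z $ i + \<xi>' $ i * frame z $ k $ i)"
          by (rule DERIV_unique)
        then show ?thesis
          by (simp add: matrix_vector_mult_def sum.distrib mult_ac)
      qed
      then have "?C *v Y z = (?C ** frame z - frame z ** A z) *v \<xi> z + frame z *v \<xi>'"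
        by (simp add: vec_eq_iff)
      also have "(?C ** frame z - frame z ** A z) *v \<xi> z = ?C *v Y z - frame z *v (A z *v \<xi> z)"
        by (simp add: matrix_vector_mult_diff_rdistrib matrix_vector_mul_assoc[symmetric] frame_\<xi>[OF z])
      finally have "frame z *v \<xi>' = frame z *v (A z *v \<xi> z)" by simp
      then have "\<xi>' = A z *v \<xi> z"
        using good[OF z] by (metis matrix_inv_mult(2) matrix_vector_mul_assoc matrix_vector_mul_lid)
      with d\<xi> show ?thesis by simp
    qed
    then have "\<xi> \<in> system_solutions A D"
      by (simp add: system_solutions_def \<xi>_def)
    moreover have "y = (\<lambda>z\<in>D. \<xi> z $ u)"
      using y first by (auto simp: scalar_solutions_def extensional_def restrict_def)
    ultimately show "\<exists>\<xi>\<in>system_solutions A D. y = (\<lambda>z\<in>D. \<xi> z $ u)" by blast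
  }
qed

section \<open>Reductions and their coefficients\<close>

lemma almost_rational_cyc: "almost_rational (\<lambda>z. cyc k z i)"
  unfolding cyc_def
  by (intro almost_rational_poly almost_rational_divide almost_rational_const almost_rational_ident)

lemma almost_rational_frame_inv:
  assumes "frame_det_poly \<noteq> 0"
  shows "almost_rational (\<lambda>z. matrix_inv (frame z) $ i $ k)"
proof (rule almost_rational_matrix_inv)
  show "\<forall>\<^sub>\<infinity>z. det (frame z) \<noteq> 0"
    using cofinite_nondegenerate[OF assms] by eventually_elim simp
qed (simp add: frame_def almost_rational_cyc)

lemma almost_rational_coef: "frame_det_poly \<noteq> 0 \<Longrightarrow> almost_rational (coef j)"
  unfolding coef_def
  by (intro almost_rational_uminus almost_rational_sum almost_rational_mult almost_rational_cyc
      almost_rational_frame_inv)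

lemma cofinite_cyc_Suc:
  assumes "\<And>i. \<forall>\<^sub>\<infinity>z. G i z = cyc k z i"
  shows "\<forall>\<^sub>\<infinity>z. deriv (G i) z + (\<Sum>j\<in>UNIV. G j z * A z $ j $ i) = cyc (Suc k) z i"
proof -
  have "\<forall>\<^sub>\<infinity>z. \<forall>j\<in>UNIV. G j z = cyc k z j"
    using assms by (intro eventually_ball_finite) auto
  moreover have "\<forall>\<^sub>\<infinity>z. deriv (G i) z = deriv (\<lambda>z. cyc k z i) z"
    by (intro cofinite_deriv_cong assms)
  moreover have "\<forall>\<^sub>\<infinity>z. z \<noteq> (0 :: complex)"
    by (simp add: eventually_cofinite)
  ultimately show ?thesis
    by eventually_elim (simp add: DERIV_imp_deriv[OF cyc_has_field_derivative])
qed

text \<open>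
  The coefficients, the gauge and its inverse are the lowest-terms versions of \<open>coef\<close>, of the frame
  and of its inverse.  The bijection is required on every open set that avoids the poles of the
  coefficients, and \<open>nondegenerate_if_regular\<close> says that the frame is invertible on such a set.
\<close>

lemma reduction_exists:
  assumes nz: "frame_det_poly \<noteq> 0"
  shows "\<exists>a. reduces_to_scalar A u a"
proof -
  have "\<forall>j. \<exists>g. rational_fun g \<and> (\<forall>\<^sub>\<infinity>z. g z = coef j z)"
    using almost_rational_lowest_terms[OF almost_rational_coef[OF nz]] by blast
  then obtain a where a: "\<And>j. rational_fun (a j)" "\<And>j. \<forall>\<^sub>\<infinity>z. a j z = coef j z"
    by metis
  have "\<forall>\<^sub>\<infinity>z. \<forall>j\<in>{..<CARD('n)}. a j z = coef j z"
    using a(2) by (intro eventually_ball_finite) auto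
  then have rel: "\<forall>\<^sub>\<infinity>z. relation_at (\<lambda>j. a j z) z"
    using cofinite_nondegenerate[OF nz] by eventually_elim (simp add: relation_iff_coef)
  have "\<forall>k i. \<exists>g. rational_fun g \<and> (\<forall>\<^sub>\<infinity>z. g z = cyc k z i)"
    using almost_rational_lowest_terms[OF almost_rational_cyc] by blast
  then obtain G0 where G0: "\<And>k i. rational_fun (G0 k i)" "\<And>k i. \<forall>\<^sub>\<infinity>z. G0 k i z = cyc k z i"
    by metis
  have "\<forall>i k. \<exists>g. rational_fun g \<and> (\<forall>\<^sub>\<infinity>z. g z = matrix_inv (frame z) $ i $ inv pos k)"
    using almost_rational_lowest_terms[OF almost_rational_frame_inv[OF nz]] by blast
  then obtain H where H: "\<And>i k. rational_fun (H i k)"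
    "\<And>i k. \<forall>\<^sub>\<infinity>z. H i k z = matrix_inv (frame z) $ i $ inv pos k"
    by metis
  \<comment> \<open>Row \<open>0\<close> is required to be the constant function everywhere, also at \<open>0\<close>, where a function
    known only off a finite set says nothing.\<close>
  define G where "G k i = (if k = 0 then (\<lambda>z. if i = u then 1 else 0) else G0 k i)" for k i
  have G: "\<forall>\<^sub>\<infinity>z. G k i z = cyc k z i" for k i
    using G0(2) by (cases "k = 0") (simp_all add: G_def cyc_0)
  have G_all: "\<forall>\<^sub>\<infinity>z. \<forall>k\<in>{..<CARD('n)}. \<forall>i\<in>UNIV. G k i z = cyc k z i"
    using G by (intro eventually_ball_finite ballI) auto
  have H_all: "\<forall>\<^sub>\<infinity>z. \<forall>i\<in>UNIV. \<forall>k\<in>{..<CARD('n)}. H i k z = matrix_inv (frame z) $ i $ inv pos k"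
    using H by (intro eventually_ball_finite ballI) auto
  have "gauge_to_companion A u a G H"
    unfolding gauge_to_companion_def
  proof (intro conjI)
    have "rational_fun (\<lambda>z. if i = u then 1 else 0)" for i
      unfolding rational_fun_def by (rule exI[of _ "if i = u then 1 else 0"], rule exI[of _ 1]) auto
    then show "\<forall>k<CARD('n). \<forall>i. rational_fun (G k i) \<and> rational_fun (H i k)"
      using G0(1) H(1) by (simp add: G_def)
    show "\<forall>i. G 0 i = (\<lambda>z. if i = u then 1 else 0)" by (simp add: G_def)
    show "\<forall>\<^sub>\<infinity>z. \<forall>i j. (\<Sum>k<CARD('n). H i k z * G k j z) = (if i = j then 1 else 0)"
      using G_all H_all cofinite_nondegenerate[OF nz]
    proof eventually_elim
      case (elim z)
      have "(\<Sum>k<CARD('n). H i k z * G k j z) = (matrix_inv (frame z) ** frame z) $ i $ j" for i j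
      proof -
        have "(\<Sum>k<CARD('n). H i k z * G k j z)
            = (\<Sum>k<CARD('n). matrix_inv (frame z) $ i $ inv pos k * cyc k z j)"
          using elim by (intro sum.cong) auto
        also have "\<dots> = (matrix_inv (frame z) ** frame z) $ i $ j"
          by (simp add: matrix_matrix_mult_def frame_def inv_pos flip: sum_pos)
        finally show ?thesis .
      qed
      with elim show ?case by (simp add: matrix_inv_mult mat_def)
    qed
    have "\<forall>\<^sub>\<infinity>z. \<forall>k\<in>{..<CARD('n)}. \<forall>i\<in>UNIV.
        deriv (G k i) z + (\<Sum>j\<in>UNIV. G k j z * A z $ j $ i) = cyc (Suc k) z i"
      using cofinite_cyc_Suc[OF G] by (intro eventually_ball_finite ballI) auto
    then show "\<forall>\<^sub>\<infinity>z. \<forall>k<CARD('n). \<forall>i. deriv (G k i) z + (\<Sum>j\<in>UNIV. G k j z * A z $ j $ i) =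
        (if Suc k < CARD('n) then G (Suc k) i z else - (\<Sum>j<CARD('n). a j z * G j i z))"
      using G_all rel
    proof eventually_elim
      case (elim z)
      show ?case
      proof (intro allI impI)
        fix k i assume k: "k < CARD('n)"
        show "deriv (G k i) z + (\<Sum>j\<in>UNIV. G k j z * A z $ j $ i) =
            (if Suc k < CARD('n) then G (Suc k) i z else - (\<Sum>j<CARD('n). a j z * G j i z))"
        proof (cases "Suc k < CARD('n)")
          case False
          then have "Suc k = CARD('n)" using k by simp
          with elim k show ?thesis by (simp add: relation_at_def)
        qed (use elim k in simp)
      qed
    qed
  qed
  moreover have "bij_betw (\<lambda>\<xi>. \<lambda>z\<in>D. \<xi> z $ u) (system_solutions A D) (scalar_solutions CARD('n) a D)"
    if D: "open D" "D \<inter> insert 0 (singular_points CARD('n) a) = {}" for D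
  proof (rule bij_betw_solutions[OF D(1)])
    fix z assume "z \<in> D"
    then have z: "z \<noteq> 0" "\<And>j. j < CARD('n) \<Longrightarrow> \<not> is_pole (a j) z"
      using D(2) by (auto simp: singular_points_def)
    have "\<forall>j\<in>{..<CARD('n)}. \<exists>r>0. a j holomorphic_on ball z r"
      using rational_fun_holomorphic_or_pole[OF a(1) z(2)] by auto
    then obtain R where R: "\<And>j. j < CARD('n) \<Longrightarrow> R j > 0 \<and> a j holomorphic_on ball z (R j)"
      by (metis lessThan_iff)
    define r where "r = Min (R ` {..<CARD('n)})"
    have "r > 0" using R by (simp add: r_def lessThan_empty_iff)
    moreover have "a j holomorphic_on ball z r" if "j < CARD('n)" for j
    proof (rule holomorphic_on_subset)
      show "a j holomorphic_on ball z (R j)" using R that by blast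
      show "ball z r \<subseteq> ball z (R j)" using that by (intro subset_ball) (simp add: r_def)
    qed
    ultimately show "z \<noteq> 0 \<and> relation_at (\<lambda>j. a j z) z \<and> det (frame z) \<noteq> 0"
      using nondegenerate_if_regular[OF z(1) _ nz _ rel, of r] z(1) by blast
  qed
  ultimately show ?thesis
    using a(1) unfolding reduces_to_scalar_def by blast
qed

text \<open>
  The gauge is forced: its row \<open>0\<close> is prescribed, and the gauge equation computes each row from the
  one before by the recursion of the \<open>e\<^sub>k\<close>.  The last gauge equation then expands \<open>e\<^sub>n\<close> in the frame,
  which determines the coefficients.
\<close>

lemma reduction_coefficients:
  assumes nz: "frame_det_poly \<noteq> 0" and red: "reduces_to_scalar A u a" and "j < CARD('n)"
  shows "\<forall>\<^sub>\<infinity>z. a j z = coef j z"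
proof -
  obtain G H where "gauge_to_companion A u a G H"
    using red unfolding reduces_to_scalar_def by blast
  then have G_0: "\<And>i. G 0 i = (\<lambda>z. if i = u then 1 else 0)"
    and step: "\<forall>\<^sub>\<infinity>z. \<forall>k<CARD('n). \<forall>i. deriv (G k i) z + (\<Sum>j\<in>UNIV. G k j z * A z $ j $ i) =
          (if Suc k < CARD('n) then G (Suc k) i z else - (\<Sum>j<CARD('n). a j z * G j i z))"
    unfolding gauge_to_companion_def by auto
  have G: "\<forall>\<^sub>\<infinity>z. G k i z = cyc k z i" if "k < CARD('n)" for k i
    using that
  proof (induction k arbitrary: i)
    case 0
    show ?case by (simp add: G_0 cyc_0)
  next
    case (Suc k)
    have "\<forall>\<^sub>\<infinity>z. deriv (G k i) z + (\<Sum>j\<in>UNIV. G k j z * A z $ j $ i) = cyc (Suc k) z i"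
      using Suc by (intro cofinite_cyc_Suc) simp
    with step show ?case
    proof eventually_elim
      case (elim z)
      then show ?case using Suc.prems by (metis Suc_lessD)
    qed
  qed
  have Suc_pred: "Suc (CARD('n) - 1) = CARD('n)" by simp
  have "\<forall>\<^sub>\<infinity>z. \<forall>i\<in>UNIV. deriv (G (CARD('n) - 1) i) z + (\<Sum>j\<in>UNIV. G (CARD('n) - 1) j z * A z $ j $ i) = cyc CARD('n) z i"
    using cofinite_cyc_Suc[of "G (CARD('n) - 1)" "CARD('n) - 1"] G[of "CARD('n) - 1"]
    by (intro eventually_ball_finite ballI) (auto simp: Suc_pred)
  moreover have "\<forall>\<^sub>\<infinity>z. \<forall>k\<in>{..<CARD('n)}. \<forall>i\<in>UNIV. G k i z = cyc k z i"
    using G by (intro eventually_ball_finite ballI) auto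
  ultimately show ?thesis
    using step cofinite_nondegenerate[OF nz]
  proof eventually_elim
    case (elim z)
    have "relation_at (\<lambda>j. a j z) z"
      unfolding relation_at_def
    proof
      fix i
      have "cyc CARD('n) z i = deriv (G (CARD('n) - 1) i) z + (\<Sum>j\<in>UNIV. G (CARD('n) - 1) j z * A z $ j $ i)"
        using elim(1) by simp
      also have "\<dots> = - (\<Sum>j<CARD('n). a j z * G j i z)"
        using elim(3)[rule_format, of "CARD('n) - 1" i] by simp
      also have "\<dots> = - (\<Sum>j<CARD('n). a j z * cyc j z i)"
        using elim(2) by simp
      finally show "cyc CARD('n) z i = - (\<Sum>j<CARD('n). a j z * cyc j z i)" .
    qed
    with elim(4) assms(3) show ?case by (simp add: relation_iff_coef)
  qed
qed

lemma singular_points_degenerate: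
  assumes nz: "frame_det_poly \<noteq> 0" and red: "reduces_to_scalar A u a"
  shows "singular_points CARD('n) a \<subseteq> {z. z \<noteq> 0 \<and> det (frame z) = 0}"
proof
  fix z assume "z \<in> singular_points CARD('n) a"
  then obtain j where j: "z \<noteq> 0" "j < CARD('n)" "is_pole (a j) z"
    by (auto simp: singular_points_def)
  let ?S = "{z. z \<noteq> 0 \<and> det (frame z) \<noteq> 0}"
  have "is_pole (coef j) z"
    using is_pole_transform[OF j(3) eventually_at_if_cofinite[OF reduction_coefficients[OF nz red j(2)]]]
    by simp
  moreover have "open ?S"
  proof -
    have "- ?S = {z. \<not> (z \<noteq> 0 \<and> det (frame z) \<noteq> 0)}" by blast
    then have "finite (- ?S)"
      using cofinite_nondegenerate[OF nz] by (simp only: eventually_cofinite)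
    then show ?thesis using finite_imp_closed open_closed by blast
  qed
  moreover have "coef j holomorphic_on ?S" by (rule coef_holomorphic) auto
  ultimately have "z \<notin> ?S" using not_is_pole_holomorphic by blast
  with j(1) show "z \<in> {z. z \<noteq> 0 \<and> det (frame z) = 0}" by blast
qed

end

section \<open>Application to Frobenius manifolds\<close>

lemma cyclic_vec_eq:
  assumes "cyclic_system (mu_matrix F c p) pos"
    and "unit_field F c p = axis u 1" and "z \<noteq> 0"
  shows "cyclic_vec F k c (z, p) $ i = cyclic_system.cyc (U_matrix F c p) (mu_matrix F c p) u k z i"
proof -
  interpret cyclic_system "U_matrix F c p" "mu_matrix F c p" u pos by fact
  show ?thesis
    using assms(3)
  proof (induction k arbitrary: z i)
    case 0
    show ?case by (simp add: cyclic_vec_def assms(2) cyc_0 axis_def)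
  next
    case (Suc k)
    let ?v = "cyclic_vec F k c (z, p)"
    have "deriv (\<lambda>w. cyclic_vec F k c (w, p) $ i) z = deriv (\<lambda>w. cyc k w i) z"
    proof (rule deriv_cong_ev)
      have "\<forall>\<^sub>F w in nhds z. w \<in> - {0}" using Suc.prems by (intro eventually_nhds_in_open) auto
      then show "\<forall>\<^sub>F w in nhds z. cyclic_vec F k c (w, p) $ i = cyc k w i"
        by eventually_elim (simp add: Suc.IH)
    qed simp
    also have "\<dots> = cyc (Suc k) z i - (\<Sum>j\<in>UNIV. cyc k z j * A z $ j $ i)"
      by (intro DERIV_imp_deriv cyc_has_field_derivative Suc.prems)
    also have "(\<Sum>j\<in>UNIV. cyc k z j * A z $ j $ i)
        = (U_matrix F c p *v ?v) $ i - (1 / z) * (mu_matrix F c p *v ?v) $ i"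
    proof -
      have "mu_matrix F c p $ j $ i = mu_matrix F c p $ i $ j" for j
        using diag by (cases "i = j") auto
      then show ?thesis
        by (simp add: A_def transpose_def matrix_vector_mult_def Suc.IH[OF Suc.prems] algebra_simps
            sum_subtractf sum_divide_distrib)
    qed
    finally show ?case
      by (simp add: cyclic_vec_def hat_nabla_z_def)
  qed
qed

theorem theorem2p29:
  fixes F :: "('m::{t2_space, second_countable_topology}, 'n::finite) frobenius"
    and c :: "('m, 'n) chart" and u :: 'n and p :: 'm
  assumes "frobenius_manifold F"
    and "euler_diagonalizable F"
    and "generically_semisimple F"
    and "p \<in> points F - A_Lambda F"
    and "adapted_flat_chart F u c" and "p \<in> fst c"
  shows "(\<exists>a. reduces_to_scalar (deformed_matrix F c p) u a) \<and>
         (\<forall>a. reduces_to_scalar (deformed_matrix F c p) u a \<longrightarrow>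
            finite (apparent_singularities CARD('n) a) \<and>
            card (apparent_singularities CARD('n) a) \<le> (CARD('n) - 1) choose 2)"
proof -
  have c: "c \<in> atlas F" "unit_field F c p = axis u 1"
    "\<And>i j. i \<noteq> j \<Longrightarrow> cov_vec (metric F) (euler_field F) c p $ i $ j = 0"
    using assms(5,6) unfolding adapted_flat_chart_def by auto
  obtain pos :: "'n \<Rightarrow> nat" where pos: "bij_betw pos UNIV {..<CARD('n)}"
    using ex_bij_betw_finite_nat[of "UNIV :: 'n set"] by (auto simp: lessThan_atLeast0)
  have sys: "cyclic_system (mu_matrix F c p) pos"
    by unfold_locales (auto simp: mu_matrix_def mat_def c(3) pos)
  interpret cyclic_system "U_matrix F c p" "mu_matrix F c p" u pos by fact
  have A: "deformed_matrix F c p = A"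
    by (simp add: fun_eq_iff deformed_matrix_def A_def)
  have nz: "frame_det_poly \<noteq> 0"
  proof -
    \<comment> \<open>As \<open>p\<close> is not in the \<open>\<A>\<^sub>\<Lambda>\<close>-stratum, the frame is nondegenerate at some \<open>z\<close>.\<close>
    have "(UNIV - {0}) \<times> {p} \<subseteq> hat_M F" using assms(4) by (auto simp: hat_M_def)
    then obtain z where z: "z \<noteq> 0" "(z, p) \<in> cyclic_stratum F"
      using assms(4) by (auto simp: A_Lambda_def)
    then have "cyclic_frame_at F (z, p)" by (auto simp: cyclic_stratum_def)
    then have span: "vec.span ((\<lambda>k. cyclic_vec F k c (z, p)) ` {..<CARD('n)}) = UNIV"
      using c(1) assms(6) by (simp add: cyclic_frame_at_def)
    have "row l (frame z) = cyclic_vec F (pos l) c (z, p)" for l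
      by (simp add: vec_eq_iff row_def frame_def cyclic_vec_eq[OF sys c(2) z(1)])
    then have "rows (frame z) = (\<lambda>k. cyclic_vec F k c (z, p)) ` range pos"
      by (auto simp: rows_def)
    also have "range pos = {..<CARD('n)}"
      using pos by (simp add: bij_betw_def)
    finally have "rows (frame z) = (\<lambda>k. cyclic_vec F k c (z, p)) ` {..<CARD('n)}" .
    then have "det (frame z) \<noteq> 0"
      using span by (simp add: matrix_left_invertible_span_rows_gen invertible_left_inverse flip: invertible_det_nz)
    then show ?thesis using poly_frame_det_poly[of z] by auto
  qed
  have "finite (apparent_singularities CARD('n) a) \<and>
        card (apparent_singularities CARD('n) a) \<le> (CARD('n) - 1) choose 2"
    if "reduces_to_scalar A u a" for a
  proof -
    let ?Z = "{z. z \<noteq> 0 \<and> det (frame z) = 0}"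
    have sub: "apparent_singularities CARD('n) a \<subseteq> ?Z"
      using singular_points_degenerate[OF nz that] by (auto simp: apparent_singularities_def)
    show ?thesis
      using degenerate_points[OF nz] card_mono[OF _ sub] finite_subset[OF sub] by auto
  qed
  with reduction_exists[OF nz] show ?thesis unfolding A by blast
qed

end
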